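(* Let $\Delta t>0$, $D>0$, $N\in\mathbb{N}$, $h=1/N$. Given $n^m,\,n^{m-1},\,p^m,\,p^{m-1}\in\mathcal{C}_{\rm per}$ with $n^m_{i,j,k},\,n^{m-1}_{i,j,k},\,p^m_{i,j,k},\,p^{m-1}_{i,j,k}>0$ for all $1\le i,j,k\le N$, and with $n^m-p^m,\ n^{m-1}-p^{m-1}\in\mathring{\mathcal{C}}_{\rm per}$, there exists a unique solution $(n^{m+1},p^{m+1})\in[\mathcal{C}_{\rm per}]^2$ of the numerical scheme (S) described in the context, with $n^{m+1}_{i,j,k}>0$ and $p^{m+1}_{i,j,k}>0$ for all $1\le i,j,k\le N$ and $n^{m+1}-p^{m+1}\in\mathring{\mathcal{C}}_{\rm per}$.
   Context: **Grid functions.** $\Omega=(0,1)^3$, $h=1/N$. $\mathcal{C}_{\rm per}$ is the space of real grid functions $f=(f_{i,j,k})_{i,j,k\in\mathbb{Z}}$ ($f_{i,j,k}$ being the value at the cell center $((i+\frac12)h,(j+\frac12)h,(k+\frac12)h)$) that are $N$-periodic in each index. $\overline f:=\frac{h^3}{|\Omega|}\sum_{i,j,k=1}^N f_{i,j,k}$ and $\mathring{\mathcal{C}}_{\rm per}:=\{f\in\mathcal{C}_{\rm per}:\overline f=0\}$. **Difference operators.** On $x$-faces: $A_xf_{i+1/2,j,k}=\frac12(f_{i+1,j,k}+f_{i,j,k})$, $D_xf_{i+1/2,j,k}=\frac1h(f_{i+1,j,k}-f_{i,j,k})$; for face functions $g$: $d_xg_{i,j,k}=\frac1h(g_{i+1/2,j,k}-g_{i-1/2,j,k})$;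 $A_y,A_z,D_y,D_z,d_y,d_z$ are defined analogously. For a function $\mathcal{M}$ defined on the faces, $\nabla_h\cdot(\mathcal{M}\nabla_h\mu)=d_x(\mathcal{M}D_x\mu)+d_y(\mathcal{M}D_y\mu)+d_z(\mathcal{M}D_z\mu)$. $\Delta_h\mu=d_x(D_x\mu)+d_y(D_y\mu)+d_z(D_z\mu)$. For $f\in\mathring{\mathcal{C}}_{\rm per}$, $(-\Delta_h)^{-1}f$ is the unique $\psi\in\mathring{\mathcal{C}}_{\rm per}$ with $-\Delta_h\psi=f$. **Mobilities.** $\mathcal{M}_n^m=n^m$, $\mathcal{M}_p^m=D\,p^m$ (same at level $m-1$), and on the faces $$(\breve{\mathcal{M}}_n^{m+1/2})_{i+1/2,j,k}=\Big(\big(A_x(\tfrac32\mathcal{M}_n^m-\tfrac12\mathcal{M}_n^{m-1})_{i+1/2,j,k}\big)^2+\Delta t^6\Big)^{1/2},$$ with the analogous formulas with $A_y$ and $A_z$ on the $y$- and $z$-faces, and $\breve{\mathcal{M}}_p^{m+1/2}$ defined in the same way from $\mathcal{M}_p^m,\mathcal{M}_p^{m-1}$. **Numerical scheme (S).** Given data at levels $m,m-1$, find (pointwise positive) $n^{m+1},p^{m+1}\in\mathcal{C}_{\rm per}$ such that $$\frac{n^{m+1}-n^m}{\Delta t}=\nabla_h\cdot\big(\breve{\mathcal{M}}_n^{m+1/2}\nabla_h\mu_n^{m+1/2}\big),\qquad \frac{p^{m+1}-p^m}{\Delta t}=\nabla_h\cdot\big(\breve{\mathcal{M}}_p^{m+1/2}\nabla_h\mu_p^{m+1/2}\big),$$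 $$\mu_n^{m+1/2}=\frac{n^{m+1}\ln n^{m+1}-n^m\ln n^m}{n^{m+1}-n^m}-1+\Delta t\ln\frac{n^{m+1}}{n^m}+(-\Delta_h)^{-1}(n^{m+1/2}-p^{m+1/2}),$$ $$\mu_p^{m+1/2}=\frac{p^{m+1}\ln p^{m+1}-p^m\ln p^m}{p^{m+1}-p^m}-1+\Delta t\ln\frac{p^{m+1}}{p^m}+(-\Delta_h)^{-1}(p^{m+1/2}-n^{m+1/2}),$$ where $n^{m+1/2}=\frac12(n^{m+1}+n^m)$, $p^{m+1/2}=\frac12(p^{m+1}+p^m)$. The quotient $\frac{u\ln u-a\ln a}{u-a}$ ($u,a>0$) is understood as its continuous extension $\ln a+1$ when $u=a$. *)

theory Defs
  imports Complex_Main
begin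

text \<open>
  A grid function is indexed by all integer triples; \<open>f i j k\<close> is its value at the cell
  centre \<open>((i+1/2)h, (j+1/2)h, (k+1/2)h)\<close>. Face functions have the same type, with the half
  index rounded down: for an x-face function, \<open>g i j k\<close> is the value at \<open>(i+1/2, j, k)\<close>,
  and correspondingly \<open>(i, j+1/2, k)\<close> on y-faces and \<open>(i, j, k+1/2)\<close> on z-faces.
  Sums, differences and negatives of grid functions are the pointwise ones.
\<close>

type_synonym grid = "int \<Rightarrow> int \<Rightarrow> int \<Rightarrow> real"

definition mesh :: "nat \<Rightarrow> real" where
  "mesh N = 1 / real N"

definition C_per :: "nat \<Rightarrow> grid set" where
  "C_per N = {f. \<forall>i j k. f (i + int N) j k = f i j k \<and>
                         f i (j + int N) k = f i j k \<and>
                         f i j (k + int N) = f i j k}"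

text \<open>The factor \<open>1/|\<Omega>|\<close> is omitted, as the unit cube has volume 1.\<close>

definition grid_mean :: "nat \<Rightarrow> grid \<Rightarrow> real" where
  "grid_mean N f = mesh N ^ 3 * (\<Sum>i=1..int N. \<Sum>j=1..int N. \<Sum>k=1..int N. f i j k)"

definition C0_per :: "nat \<Rightarrow> grid set" where
  "C0_per N = {f \<in> C_per N. grid_mean N f = 0}"

definition grid_pos :: "nat \<Rightarrow> grid \<Rightarrow> bool" where
  "grid_pos N f \<longleftrightarrow>
     (\<forall>i\<in>{1..int N}. \<forall>j\<in>{1..int N}. \<forall>k\<in>{1..int N}. f i j k > 0)"

text \<open>
  \<open>Ax\<close>, \<open>Dx\<close> map cell-centred functions to x-face functions; \<open>dx\<close> maps x-face functions
  to cell-centred ones. With the above index convention the faces \<open>i+1/2\<close> and \<open>i-1/2\<close>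
  have indices \<open>i\<close> and \<open>i-1\<close>.
\<close>

definition Ax :: "grid \<Rightarrow> grid" where
  "Ax f i j k = (f (i + 1) j k + f i j k) / 2"

definition Ay :: "grid \<Rightarrow> grid" where
  "Ay f i j k = (f i (j + 1) k + f i j k) / 2"

definition Az :: "grid \<Rightarrow> grid" where
  "Az f i j k = (f i j (k + 1) + f i j k) / 2"

definition Dx :: "nat \<Rightarrow> grid \<Rightarrow> grid" where
  "Dx N f i j k = (f (i + 1) j k - f i j k) / mesh N"

definition Dy :: "nat \<Rightarrow> grid \<Rightarrow> grid" where
  "Dy N f i j k = (f i (j + 1) k - f i j k) / mesh N"

definition Dz :: "nat \<Rightarrow> grid \<Rightarrow> grid" where
  "Dz N f i j k = (f i j (k + 1) - f i j k) / mesh N"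

definition dx :: "nat \<Rightarrow> grid \<Rightarrow> grid" where
  "dx N g i j k = (g i j k - g (i - 1) j k) / mesh N"

definition dy :: "nat \<Rightarrow> grid \<Rightarrow> grid" where
  "dy N g i j k = (g i j k - g i (j - 1) k) / mesh N"

definition dz :: "nat \<Rightarrow> grid \<Rightarrow> grid" where
  "dz N g i j k = (g i j k - g i j (k - 1)) / mesh N"

text \<open>
  \<open>\<nabla>\<^sub>h \<cdot> (M \<nabla>\<^sub>h \<mu>)\<close>, where the face function \<open>M\<close> is given by its restrictions \<open>Mx\<close>, \<open>My\<close>,
  \<open>Mz\<close> to the x-, y- and z-faces.
\<close>

definition div_grad :: "nat \<Rightarrow> grid \<Rightarrow> grid \<Rightarrow> grid \<Rightarrow> grid \<Rightarrow> grid" where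
  "div_grad N Mx My Mz \<mu> i j k =
     dx N (\<lambda>i j k. Mx i j k * Dx N \<mu> i j k) i j k +
     dy N (\<lambda>i j k. My i j k * Dy N \<mu> i j k) i j k +
     dz N (\<lambda>i j k. Mz i j k * Dz N \<mu> i j k) i j k"

definition laplace :: "nat \<Rightarrow> grid \<Rightarrow> grid" where
  "laplace N \<mu> i j k =
     dx N (Dx N \<mu>) i j k + dy N (Dy N \<mu>) i j k + dz N (Dz N \<mu>) i j k"

text \<open>The inverse of \<open>-\<Delta>\<^sub>h\<close>; meaningful only for \<open>f \<in> C0_per N\<close>.\<close>

definition inv_neg_laplace :: "nat \<Rightarrow> grid \<Rightarrow> grid" where
  "inv_neg_laplace N f = (THE \<psi>. \<psi> \<in> C0_per N \<and> - laplace N \<psi> = f)"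

text \<open>
  The regularised face mobilities, from the mobilities \<open>M1\<close> at level \<open>m\<close> and \<open>M0\<close> at
  level \<open>m-1\<close>.
\<close>

definition mobx :: "real \<Rightarrow> grid \<Rightarrow> grid \<Rightarrow> grid" where
  "mobx \<Delta>t M1 M0 i j k =
     sqrt ((Ax (\<lambda>i j k. 3/2 * M1 i j k - 1/2 * M0 i j k) i j k)^2 + \<Delta>t^6)"

definition moby :: "real \<Rightarrow> grid \<Rightarrow> grid \<Rightarrow> grid" where
  "moby \<Delta>t M1 M0 i j k =
     sqrt ((Ay (\<lambda>i j k. 3/2 * M1 i j k - 1/2 * M0 i j k) i j k)^2 + \<Delta>t^6)"

definition mobz :: "real \<Rightarrow> grid \<Rightarrow> grid \<Rightarrow> grid" where
  "mobz \<Delta>t M1 M0 i j k =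
     sqrt ((Az (\<lambda>i j k. 3/2 * M1 i j k - 1/2 * M0 i j k) i j k)^2 + \<Delta>t^6)"

definition mob_n :: "grid \<Rightarrow> grid" where
  "mob_n n = n"

definition mob_p :: "real \<Rightarrow> grid \<Rightarrow> grid" where
  "mob_p D p = (\<lambda>i j k. D * p i j k)"

definition ent_quot :: "real \<Rightarrow> real \<Rightarrow> real" where
  "ent_quot u a = (if u = a then ln a + 1 else (u * ln u - a * ln a) / (u - a))"

definition mid :: "grid \<Rightarrow> grid \<Rightarrow> grid" where
  "mid u a = (\<lambda>i j k. (u i j k + a i j k) / 2)"

text \<open>
  The chemical potential of the species with values \<open>u\<close> at level \<open>m+1\<close> and \<open>a\<close> at level \<open>m\<close>,
  the other species having values \<open>v\<close> and \<open>b\<close>; \<open>\<mu>\<^sub>n\<close> and \<open>\<mu>\<^sub>p\<close> differ only by exchanging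
  the two species.
\<close>

definition chem_pot :: "nat \<Rightarrow> real \<Rightarrow> grid \<Rightarrow> grid \<Rightarrow> grid \<Rightarrow> grid \<Rightarrow> grid" where
  "chem_pot N \<Delta>t u a v b i j k =
     ent_quot (u i j k) (a i j k) - 1 + \<Delta>t * ln (u i j k / a i j k)
     + inv_neg_laplace N (mid u a - mid v b) i j k"

text \<open>
  \<open>n0\<close>, \<open>n1\<close>, \<open>n2\<close> are the values at levels \<open>m-1\<close>, \<open>m\<close>, \<open>m+1\<close>; likewise for \<open>p\<close>.
\<close>

definition scheme ::
  "nat \<Rightarrow> real \<Rightarrow> real \<Rightarrow> grid \<Rightarrow> grid \<Rightarrow> grid \<Rightarrow> grid \<Rightarrow> grid \<Rightarrow> grid \<Rightarrow> bool" where
  "scheme N \<Delta>t D n0 n1 p0 p1 n2 p2 \<longleftrightarrow>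
     (\<forall>i j k.
        (n2 i j k - n1 i j k) / \<Delta>t =
          div_grad N (mobx \<Delta>t (mob_n n1) (mob_n n0))
                     (moby \<Delta>t (mob_n n1) (mob_n n0))
                     (mobz \<Delta>t (mob_n n1) (mob_n n0))
                     (chem_pot N \<Delta>t n2 n1 p2 p1) i j k \<and>
        (p2 i j k - p1 i j k) / \<Delta>t =
          div_grad N (mobx \<Delta>t (mob_p D p1) (mob_p D p0))
                     (moby \<Delta>t (mob_p D p1) (mob_p D p0))
                     (mobz \<Delta>t (mob_p D p1) (mob_p D p0))
                     (chem_pot N \<Delta>t p2 p1 n2 n1) i j k)"

end

theory Submission
  imports Defs "HOL-Analysis.Analysis"
begin

text \<open>
  For fixed \<open>r > 0\<close> the local part \<open>\<phi>\<^sub>r(u)\<close> of the chemical potential is an increasing bijection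
  from \<open>(0, \<infinity>)\<close> onto the reals: the entropy quotient is a slope of the convex function
  \<open>x ln x\<close>, and the term \<open>\<Delta>t ln (u/r)\<close> makes it unbounded in both directions. Taking the local
  potentials \<open>a = \<phi>\<^sub>n(u)\<close>, \<open>b = \<phi>\<^sub>p(v)\<close> of the new densities and the electric potential \<open>\<psi>\<close> as unknowns turns the scheme
  into the Euler-Lagrange equations of an unconstrained functional
  \<open>\<Sum> (\<Phi>\<^sub>n(a) - n a) + \<Sum> (\<Phi>\<^sub>p(b) - p b) - 2 \<Sum> (n - p) \<psi> + \<Delta>t/2 |\<nabla>(a + \<psi>)|\<^sup>2 + \<Delta>t/2 |\<nabla>(b - \<psi>)|\<^sup>2
  + |\<nabla>\<psi>|\<^sup>2 + (\<Sum> \<psi>)\<^sup>2\<close>, with mobility weights in the two middle gradients and \<open>\<Phi>' = \<phi>\<^sup>-\<^sup>1\<close>.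
  It is coercive by a discrete Poincare inequality, so it has a minimiser, and positivity is
  automatic because \<open>\<phi>\<^sup>-\<^sup>1\<close> takes positive values. The penalty \<open>(\<Sum> \<psi>)\<^sup>2\<close> removes the invariance
  under shifts by constants and, by charge neutrality, forces \<open>\<psi>\<close> to have mean zero.
  Uniqueness: testing the difference of two solutions with the difference of the potentials gives
  a sum of nonnegative terms that is at most zero.
\<close>

section \<open>The local chemical potential and its inverse\<close>

text \<open>This is the bound \<open>ln x \<le> x - 1\<close> at \<open>x = r / v\<close>,
  multiplied by \<open>v\<close>.\<close>

lemma xlnx_above_tangent:
  fixes r v :: real
  assumes "r > 0" "v > 0"
  shows "(ln r + 1) * (v - r) \<le> v * ln v - r * ln r"
proof -
  have "ln (r / v) \<le> r / v - 1"
    using assms by (intro ln_le_minus_one) simp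
  hence "v * ln (r / v) \<le> v * (r / v - 1)"
    using assms by simp
  thus ?thesis
    using assms by (simp add: ln_div algebra_simps)
qed

lemma convex_on_xlnx: "convex_on {0<..} (\<lambda>x::real. x * ln x)"
  by (rule pos_convex_function[where f' = "\<lambda>x. ln x + 1"])
     (use xlnx_above_tangent in auto)

lemma ent_quot_le:
  assumes "r > 0" "0 < u" "u \<le> r"
  shows "ent_quot u r \<le> ln r + 1"
  using xlnx_above_tangent[of r u] assms
  by (cases "u = r") (auto simp: ent_quot_def divide_simps algebra_simps)

lemma ent_quot_ge:
  assumes "r > 0" "r \<le> u"
  shows "ent_quot u r \<ge> ln r + 1"
  using xlnx_above_tangent[of r u] assms
  by (cases "u = r") (auto simp: ent_quot_def divide_simps algebra_simps)

text \<open>If \<open>r\<close> separates the two points, both chord slopes are compared with the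
  tangent slope \<open>ln r + 1\<close>. If both points lie on one side of \<open>r\<close>, the
  slopes of chords of a convex function through a fixed point increase.\<close>

lemma ent_quot_mono:
  assumes r: "r > 0" and u: "0 < u" and uv: "u \<le> v"
  shows "ent_quot u r \<le> ent_quot v r"
proof -
  consider "u = v" | "u \<le> r" "r \<le> v" | "r < u" "u < v" | "u < v" "v < r"
    using uv by linarith
  thus ?thesis
  proof cases
    case 2
    thus ?thesis using ent_quot_le[OF r u] ent_quot_ge[OF r, of v] by simp
  next
    case 3
    thus ?thesis using convex_on_slope_le(1)[OF convex_on_xlnx, of r v u] r
        minus_divide_divide[of "u * ln u - r * ln r" "u - r"]
        minus_divide_divide[of "v * ln v - r * ln r" "v - r"]
      by (simp add: ent_quot_def)
  next
    case 4
    thus ?thesis using convex_on_slope_le(2)[OF convex_on_xlnx, of u r v] r u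
      by (simp add: ent_quot_def)
  qed auto
qed

lemma isCont_ent_quot:
  assumes r: "r > 0" and u: "u > 0"
  shows "isCont (\<lambda>u. ent_quot u r) u"
proof (cases "u = r")
  case True
  have "((\<lambda>x. x * ln x) has_real_derivative ln r + 1) (at r)"
    using r by (auto intro!: derivative_eq_intros)
  \<comment> \<open>Caratheodory's form of differentiability: \<open>g\<close> is the difference
    quotient with the derivative filled in at \<open>r\<close>, which is exactly
    \<open>ent_quot\<close>.\<close>
  then obtain g where g: "\<forall>z. z * ln z - r * ln r = g z * (z - r)" "isCont g r" "g r = ln r + 1"
    unfolding CARAT_DERIV by blast
  have "(\<lambda>u. ent_quot u r) = g"
    using g(1,3) by (auto simp: ent_quot_def fun_eq_iff)
  thus ?thesis using True g(2) by simp
next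
  case False
  have "isCont (\<lambda>u. (u * ln u - r * ln r) / (u - r)) u"
    using u False by (intro continuous_intros) auto
  moreover have "\<forall>\<^sub>F x in nhds u. ent_quot x r = (x * ln x - r * ln r) / (x - r)"
    using t1_space_nhds[OF False] by eventually_elim (simp add: ent_quot_def)
  ultimately show ?thesis
    by (simp add: isCont_cong)
qed

text \<open>The part of \<open>chem_pot\<close> that is local to one cell, with
  \<open>\<tau>\<close> for the time step and \<open>r\<close> for the old density.\<close>

definition cell_pot :: "real \<Rightarrow> real \<Rightarrow> real \<Rightarrow> real" where
  "cell_pot \<tau> r u = ent_quot u r - 1 + \<tau> * ln (u / r)"

text \<open>Strictness comes from the logarithmic term; the quotient contributes a weak
  inequality.\<close>

lemma cell_pot_strict_mono:
  assumes "\<tau> > 0" "r > 0" "0 < u" "u < v"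
  shows "cell_pot \<tau> r u < cell_pot \<tau> r v"
proof -
  have "u / r < v / r" "0 < u / r" "0 < v / r"
    using assms by (auto simp: divide_strict_right_mono)
  hence "\<tau> * ln (u / r) < \<tau> * ln (v / r)"
    using assms(1) by (intro mult_strict_left_mono) (auto simp del: zero_less_divide_iff)
  thus ?thesis
    unfolding cell_pot_def using ent_quot_mono[of r u v] assms by linarith
qed

lemma cell_pot_self: "r > 0 \<Longrightarrow> cell_pot \<tau> r r = ln r"
  by (simp add: cell_pot_def ent_quot_def)

lemma isCont_cell_pot: "r > 0 \<Longrightarrow> u > 0 \<Longrightarrow> isCont (cell_pot \<tau> r) u"
  unfolding cell_pot_def by (intro continuous_intros isCont_ent_quot) auto

lemma cell_pot_surj:
  assumes \<tau>: "\<tau> > 0" and r: "r > 0"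
  shows "\<exists>u>0. cell_pot \<tau> r u = s"
proof -
  \<comment> \<open>Scaling \<open>r\<close> by \<open>exp d\<close> or \<open>exp (- d)\<close>
    moves the logarithmic term by exactly \<open>|s - ln r|\<close>. The quotient moves in the same
    direction, so the potentials at \<open>u\<close> and \<open>v\<close> bracket
    \<open>s\<close>.\<close>
  define d where "d = \<bar>s - ln r\<bar> / \<tau>"
  have d: "d \<ge> 0" "\<tau> * d = \<bar>s - ln r\<bar>" using \<tau> by (auto simp: d_def)
  define u where "u = r * exp (- d)"
  define v where "v = r * exp d"
  have uv: "0 < u" "u \<le> r" "r \<le> v"
    using r d by (auto simp: u_def v_def mult_le_cancel_left1 mult_le_cancel_left2)
  have "cell_pot \<tau> r u \<le> s"
    using ent_quot_le[OF r uv(1,2)] r d by (simp add: cell_pot_def u_def)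
  moreover have "s \<le> cell_pot \<tau> r v"
    using ent_quot_ge[OF r uv(3)] r d by (simp add: cell_pot_def v_def)
  moreover have "u \<le> v" using uv by simp
  moreover have "continuous_on {u..v} (cell_pot \<tau> r)"
    using uv r by (intro continuous_at_imp_continuous_on ballI isCont_cell_pot) auto
  ultimately obtain x where "u \<le> x" "x \<le> v" "cell_pot \<tau> r x = s"
    using IVT'[of "cell_pot \<tau> r" u s v] by blast
  thus ?thesis using uv by (intro exI[of _ x]) auto
qed

text \<open>The inverse of \<open>cell_pot \<tau> r\<close>: it returns the positive density
  belonging to a local potential.\<close>

definition cell_resp :: "real \<Rightarrow> real \<Rightarrow> real \<Rightarrow> real" where
  "cell_resp \<tau> r s = (THE u. u > 0 \<and> cell_pot \<tau> r u = s)"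

lemma cell_resp_cell_pot:
  assumes "\<tau> > 0" "r > 0" "u > 0"
  shows "cell_resp \<tau> r (cell_pot \<tau> r u) = u"
  unfolding cell_resp_def
proof (rule the_equality)
  show "v = u" if "v > 0 \<and> cell_pot \<tau> r v = cell_pot \<tau> r u" for v
    using that assms cell_pot_strict_mono[of \<tau> r u v] cell_pot_strict_mono[of \<tau> r v u]
    by (cases u v rule: linorder_cases) auto
qed (use assms in auto)

lemma cell_resp:
  assumes "\<tau> > 0" "r > 0"
  shows "cell_resp \<tau> r s > 0" "cell_pot \<tau> r (cell_resp \<tau> r s) = s"
  using cell_pot_surj[OF assms, of s] cell_resp_cell_pot[OF assms] by auto

lemma cell_resp_strict_mono:
  assumes "\<tau> > 0" "r > 0" "s < t"
  shows "cell_resp \<tau> r s < cell_resp \<tau> r t"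
proof (rule ccontr)
  assume "\<not> ?thesis"
  hence "cell_pot \<tau> r (cell_resp \<tau> r t) \<le> cell_pot \<tau> r (cell_resp \<tau> r s)"
    using cell_pot_strict_mono[OF assms(1,2), of "cell_resp \<tau> r t" "cell_resp \<tau> r s"]
      cell_resp(1)[OF assms(1,2), of t] by force
  thus False using assms cell_resp(2) by simp
qed

lemma isCont_cell_resp:
  assumes "\<tau> > 0" "r > 0"
  shows "isCont (cell_resp \<tau> r) s"
proof -
  note pos = cell_resp(1)[OF assms, of s]
  have "isCont (cell_resp \<tau> r) (cell_pot \<tau> r (cell_resp \<tau> r s))"
    by (rule isCont_inverse_function2[of "cell_resp \<tau> r s / 2" _ "cell_resp \<tau> r s * 2"])
       (use pos assms cell_resp_cell_pot isCont_cell_pot in auto)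
  thus ?thesis by (simp add: cell_resp(2)[OF assms])
qed

section \<open>The convex primitive of the inverse potential\<close>

lemma cell_energy_exists:
  assumes "\<tau> > 0" "r > 0"
  shows "\<exists>\<Phi>. \<forall>x. (\<Phi> has_real_derivative cell_resp \<tau> r x) (at x)"
  using einterval_antiderivative[of "-\<infinity>" "\<infinity>" "cell_resp \<tau> r"] isCont_cell_resp[OF assms]
  by (auto simp: has_real_derivative_iff_has_vector_derivative)

text \<open>The function \<open>\<Phi>\<close> of the variational functional. Its additive constant
  is left open, since it affects neither derivatives nor minimisers.\<close>

definition cell_energy :: "real \<Rightarrow> real \<Rightarrow> real \<Rightarrow> real" where
  "cell_energy \<tau> r = (SOME \<Phi>. \<forall>x. (\<Phi> has_real_derivative cell_resp \<tau> r x) (at x))"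

lemma DERIV_cell_energy:
  assumes "\<tau> > 0" "r > 0"
  shows "(cell_energy \<tau> r has_real_derivative cell_resp \<tau> r x) (at x)"
  using someI_ex[OF cell_energy_exists[OF assms]] by (simp add: cell_energy_def)

text \<open>The derivative \<open>cell_resp\<close> is increasing, so the energy is convex and lies
  above its tangents.\<close>

lemma cell_energy_above_tangent:
  assumes "\<tau> > 0" "r > 0"
  shows "cell_energy \<tau> r x + cell_resp \<tau> r x * (y - x) \<le> cell_energy \<tau> r y"
proof -
  have "convex_on UNIV (cell_energy \<tau> r)"
    by (rule convex_on_realI[OF _ DERIV_cell_energy[OF assms]])
       (use cell_resp_strict_mono[OF assms] in \<open>auto simp: le_less\<close>)
  from convex_on_imp_above_tangent[OF this _ _ _ DERIV_cell_energy[OF assms], of x y]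
  show ?thesis by simp
qed

text \<open>
  The slope of the energy passes the value \<open>r\<close> at \<open>ln r\<close>; the tangents one unit to
  either side give the bound.
\<close>

lemma cell_energy_coercive:
  assumes "\<tau> > 0" "r > 0"
  shows "\<exists>e>0. \<exists>C. \<forall>s. e * \<bar>s\<bar> - C \<le> cell_energy \<tau> r s - r * s"
proof -
  let ?g = "cell_resp \<tau> r" and ?E = "cell_energy \<tau> r"
  define x y where "x = ln r + 1" and "y = ln r - 1"
  have "?g (ln r) = r"
    using cell_resp_cell_pot[OF assms assms(2)] cell_pot_self[OF assms(2)] by simp
  hence g: "?g y < r" "r < ?g x"
    using cell_resp_strict_mono[OF assms, of y "ln r"] cell_resp_strict_mono[OF assms, of "ln r" x]
    by (auto simp: x_def y_def)
  define e where "e = min (?g x - r) (r - ?g y)"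
  define C where "C = max (?g x * x - ?E x) (?g y * y - ?E y)"
  have "e * \<bar>s\<bar> - C \<le> ?E s - r * s" for s
  proof (cases "s \<ge> 0")
    case True
    have "e * s \<le> (?g x - r) * s" using True by (intro mult_right_mono) (auto simp: e_def)
    moreover have "?E x + ?g x * (s - x) \<le> ?E s" by (rule cell_energy_above_tangent[OF assms])
    moreover have "?g x * x - ?E x \<le> C" by (simp add: C_def)
    ultimately show ?thesis using True by (simp add: algebra_simps)
  next
    case False
    have "e * (- s) \<le> (r - ?g y) * (- s)" using False by (intro mult_right_mono) (auto simp: e_def)
    moreover have "?E y + ?g y * (s - y) \<le> ?E s" by (rule cell_energy_above_tangent[OF assms])
    moreover have "?g y * y - ?E y \<le> C" by (simp add: C_def)
    ultimately show ?thesis using False by (simp add: algebra_simps)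
  qed
  moreover have "e > 0" using g by (simp add: e_def)
  ultimately show ?thesis by blast
qed

section \<open>Periodic grid functions\<close>

lemma C_perI:
  assumes "\<And>i j k. f (i + int N) j k = f i j k"
    and "\<And>i j k. f i (j + int N) k = f i j k"
    and "\<And>i j k. f i j (k + int N) = f i j k"
  shows "f \<in> C_per N"
  using assms by (simp add: C_per_def)

lemma C_perD:
  assumes "f \<in> C_per N"
  shows "f (i + int N) j k = f i j k" "f i (j + int N) k = f i j k" "f i j (k + int N) = f i j k"
    "f (i + int N + 1) j k = f (i + 1) j k" "f i (j + int N + 1) k = f i (j + 1) k"
    "f i j (k + int N + 1) = f i j (k + 1)"
    "f (i + int N - 1) j k = f (i - 1) j k" "f i (j + int N - 1) k = f i (j - 1) k"
    "f i j (k + int N - 1) = f i j (k - 1)"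
proof -
  have *: "f (i + int N) j k = f i j k" "f i (j + int N) k = f i j k" "f i j (k + int N) = f i j k"
    for i j k using assms by (auto simp: C_per_def)
  show "f (i + int N) j k = f i j k" "f i (j + int N) k = f i j k" "f i j (k + int N) = f i j k"
    by (fact *)+
  show "f (i + int N + 1) j k = f (i + 1) j k" "f i (j + int N + 1) k = f i (j + 1) k"
    "f i j (k + int N + 1) = f i j (k + 1)"
    using *(1)[of "i + 1" j k] *(2)[of i "j + 1" k] *(3)[of i j "k + 1"] by (simp_all add: ac_simps)
  show "f (i + int N - 1) j k = f (i - 1) j k" "f i (j + int N - 1) k = f i (j - 1) k"
    "f i j (k + int N - 1) = f i j (k - 1)"
    using *(1)[of "i - 1" j k] *(2)[of i "j - 1" k] *(3)[of i j "k - 1"]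
    by (simp_all add: algebra_simps)
qed

lemma C_per_const [simp]: "(\<lambda>i j k. c) \<in> C_per N"
  by (rule C_perI) auto

lemma C_per_map: "f \<in> C_per N \<Longrightarrow> (\<lambda>i j k. \<phi> (f i j k)) \<in> C_per N"
  by (rule C_perI) (auto simp: C_perD)

lemma C_per_map2:
  "f \<in> C_per N \<Longrightarrow> g \<in> C_per N \<Longrightarrow> (\<lambda>i j k. \<phi> (f i j k) (g i j k)) \<in> C_per N"
  by (rule C_perI) (auto simp: C_perD)

lemma C_per_diff: "f \<in> C_per N \<Longrightarrow> g \<in> C_per N \<Longrightarrow> f - g \<in> C_per N"
  by (auto simp: C_per_def)

lemma int_periodic:
  fixes f :: "int \<Rightarrow> 'a"
  assumes "\<And>i. f (i + p) = f i"
  shows "f (i + m * p) = f i"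
proof (induction m rule: int_induct[where k = 0])
  case (step1 m)
  thus ?case using assms[of "i + m * p"] by (simp add: algebra_simps)
next
  case (step2 m)
  thus ?case using assms[of "i + (m - 1) * p"] by (simp add: algebra_simps)
qed simp

lemma int_periodic_rep:
  fixes f :: "int \<Rightarrow> 'a"
  assumes "\<And>i. f (i + p) = f i"
  shows "f ((i - 1) mod p + 1) = f i"
proof -
  have "(i - 1) mod p + 1 + ((i - 1) div p) * p = i" by simp
  thus ?thesis using int_periodic[of f p "(i - 1) mod p + 1" "(i - 1) div p"] assms by simp
qed

text \<open>The representative of \<open>i\<close> modulo \<open>N\<close> in \<open>{1..N}\<close>;
  the shifts by one account for indices that start at 1. Through it, information on one period
  reaches all integer triples.\<close>

definition rep :: "nat \<Rightarrow> int \<Rightarrow> int" where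
  "rep N i = (i - 1) mod int N + 1"

lemma rep_in: "N \<ge> 1 \<Longrightarrow> rep N i \<in> {1..int N}"
  by (auto simp: rep_def add1_zle_eq)

lemma C_per_rep:
  assumes "f \<in> C_per N"
  shows "f (rep N i) (rep N j) (rep N k) = f i j k"
proof -
  have "f (rep N i) j k = f i j k" for i j k
    unfolding rep_def by (rule int_periodic_rep) (simp add: C_perD[OF assms])
  moreover have "f i (rep N j) k = f i j k" for i j k
    unfolding rep_def by (rule int_periodic_rep[of "\<lambda>j. f i j k"]) (simp add: C_perD[OF assms])
  moreover have "f i j (rep N k) = f i j k" for i j k
    unfolding rep_def by (rule int_periodic_rep[of "\<lambda>k. f i j k"]) (simp add: C_perD[OF assms])
  ultimately show ?thesis by simp
qed

lemma grid_pos_C_per: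
  assumes "N \<ge> 1" "f \<in> C_per N" "grid_pos N f"
  shows "f i j k > 0"
  using assms(3) rep_in[OF assms(1)] C_per_rep[OF assms(2), of i j k]
  unfolding grid_pos_def by metis

section \<open>Sums over one period\<close>

definition gsum :: "nat \<Rightarrow> grid \<Rightarrow> real" where
  "gsum N f = (\<Sum>i=1..int N. \<Sum>j=1..int N. \<Sum>k=1..int N. f i j k)"

lemma grid_mean_eq_0_iff: "N \<ge> 1 \<Longrightarrow> grid_mean N f = 0 \<longleftrightarrow> gsum N f = 0"
  by (simp add: grid_mean_def gsum_def mesh_def)

lemma gsum_add: "gsum N (\<lambda>i j k. f i j k + g i j k) = gsum N f + gsum N g"
  and gsum_diff: "gsum N (\<lambda>i j k. f i j k - g i j k) = gsum N f - gsum N g"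
  and gsum_cmult: "gsum N (\<lambda>i j k. c * f i j k) = c * gsum N f"
  and gsum_minus: "gsum N (\<lambda>i j k. - f i j k) = - gsum N f"
  and gsum_const: "gsum N (\<lambda>i j k. c) = real N ^ 3 * c"
  by (simp_all add: gsum_def sum.distrib sum_subtractf sum_negf flip: sum_distrib_left)
     (simp add: power3_eq_cube)

lemma gsum_mono: "(\<And>i j k. f i j k \<le> g i j k) \<Longrightarrow> gsum N f \<le> gsum N g"
  unfolding gsum_def by (intro sum_mono)

lemma gsum_nonneg: "(\<And>i j k. f i j k \<ge> 0) \<Longrightarrow> gsum N f \<ge> 0"
  unfolding gsum_def by (intro sum_nonneg)

lemma abs_gsum_le: "\<bar>gsum N f\<bar> \<le> gsum N (\<lambda>i j k. \<bar>f i j k\<bar>)"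
  using gsum_mono[of f "\<lambda>i j k. \<bar>f i j k\<bar>" N] gsum_mono[of "\<lambda>i j k. - f i j k" "\<lambda>i j k. \<bar>f i j k\<bar>" N]
  by (auto simp: gsum_minus abs_le_iff)

text \<open>Turns a bound on a sum into a pointwise bound. An index outside the period is first
  moved into it by \<open>rep\<close>.\<close>

lemma le_gsum:
  assumes "N \<ge> 1" "f \<in> C_per N" "\<And>i j k. f i j k \<ge> 0"
  shows "f i j k \<le> gsum N f"
proof -
  let ?I = "{1..int N}"
  have "f i j k = f (rep N i) (rep N j) (rep N k)" using assms(2) by (simp add: C_per_rep)
  also have "\<dots> \<le> (\<Sum>k\<in>?I. f (rep N i) (rep N j) k)"
    by (rule member_le_sum) (use assms rep_in in auto)
  also have "\<dots> \<le> (\<Sum>j\<in>?I. \<Sum>k\<in>?I. f (rep N i) j k)"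
    by (rule member_le_sum[of _ _ "\<lambda>j. \<Sum>k\<in>?I. f (rep N i) j k"])
       (use assms rep_in in \<open>auto intro: sum_nonneg\<close>)
  also have "\<dots> \<le> (\<Sum>i\<in>?I. \<Sum>j\<in>?I. \<Sum>k\<in>?I. f i j k)"
    by (rule member_le_sum[of _ _ "\<lambda>i. \<Sum>j\<in>?I. \<Sum>k\<in>?I. f i j k"])
       (use assms rep_in in \<open>auto intro!: sum_nonneg\<close>)
  finally show ?thesis by (simp add: gsum_def)
qed

lemma gsum_eq_0D:
  assumes "N \<ge> 1" "f \<in> C_per N" "\<And>i j k. f i j k \<ge> 0" "gsum N f \<le> 0"
  shows "f i j k = 0"
  using le_gsum[OF assms(1-3), of i j k] assms(3)[of i j k] assms(4) by linarith

section \<open>Translation invariance and summation by parts\<close>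

lemma sum_int_periodic_shift:
  fixes f :: "int \<Rightarrow> 'a::cancel_comm_monoid_add"
  assumes "\<And>i. f (i + int N) = f i"
  shows "(\<Sum>i=1..int N. f (i + 1)) = (\<Sum>i=1..int N. f i)"
proof -
  have "(\<Sum>i=1..int N. f (i + 1)) = (\<Sum>i=2..int N + 1. f i)"
    by (rule sum.reindex_bij_witness[of _ "\<lambda>i. i - 1" "\<lambda>i. i + 1"]) auto
  \<comment> \<open>Adding \<open>f 1\<close> completes the range to \<open>{1..N+1}\<close>.
    Splitting off the last index instead of the first gives \<open>f (N+1) = f 1\<close>, and the
    added term cancels.\<close>
  also have "\<dots> + f 1 = sum f (insert 1 {2..int N + 1})" by (simp add: add.commute)
  also have "insert 1 {2..int N + 1} = insert (1 + int N) {1..int N}" by auto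
  also have "sum f \<dots> = sum f {1..int N} + f 1" using assms[of 1] by (simp add: add.commute)
  finally show ?thesis by simp
qed

lemma gsum_shift:
  assumes "f \<in> C_per N"
  shows "gsum N (\<lambda>i j k. f (i + 1) j k) = gsum N f"
    and "gsum N (\<lambda>i j k. f i (j + 1) k) = gsum N f"
    and "gsum N (\<lambda>i j k. f i j (k + 1)) = gsum N f"
proof -
  show "gsum N (\<lambda>i j k. f (i + 1) j k) = gsum N f"
    unfolding gsum_def
    by (rule sum_int_periodic_shift[of "\<lambda>i. \<Sum>j=1..int N. \<Sum>k=1..int N. f i j k"])
       (simp add: C_perD[OF assms])
  show "gsum N (\<lambda>i j k. f i (j + 1) k) = gsum N f"
    unfolding gsum_def
    by (intro sum.cong refl sum_int_periodic_shift[of "\<lambda>j. \<Sum>k=1..int N. f _ j k"])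
       (simp add: C_perD[OF assms])
  show "gsum N (\<lambda>i j k. f i j (k + 1)) = gsum N f"
    unfolding gsum_def
    by (intro sum.cong refl sum_int_periodic_shift) (simp add: C_perD[OF assms])
qed

text \<open>By the discrete product rule the two sums add up to the sum of a translate of a periodic
  function by one cell minus the function itself, which vanishes by translation invariance.\<close>

lemma gsum_by_parts:
  assumes "f \<in> C_per N" "g \<in> C_per N"
  shows "gsum N (\<lambda>i j k. dx N g i j k * f i j k) = - gsum N (\<lambda>i j k. g i j k * Dx N f i j k)"
    and "gsum N (\<lambda>i j k. dy N g i j k * f i j k) = - gsum N (\<lambda>i j k. g i j k * Dy N f i j k)"
    and "gsum N (\<lambda>i j k. dz N g i j k * f i j k) = - gsum N (\<lambda>i j k. g i j k * Dz N f i j k)"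
proof -
  have "gsum N (\<lambda>i j k. dx N g i j k * f i j k) + gsum N (\<lambda>i j k. g i j k * Dx N f i j k)
      = gsum N (\<lambda>i j k. (g i j k * f (i + 1) j k) / mesh N - (g (i - 1) j k * f i j k) / mesh N)"
    unfolding gsum_add[symmetric]
    by (intro arg_cong[where f = "gsum N"] ext) (simp add: dx_def Dx_def field_simps add_divide_distrib diff_divide_distrib)
  also have "\<dots> = 0"
    using gsum_shift(1)[of "\<lambda>i j k. (g (i - 1) j k * f i j k) / mesh N" N]
    by (simp add: gsum_diff C_perI C_perD[OF assms(1)] C_perD[OF assms(2)])
  finally show "gsum N (\<lambda>i j k. dx N g i j k * f i j k) = - gsum N (\<lambda>i j k. g i j k * Dx N f i j k)"
    by simp
  have "gsum N (\<lambda>i j k. dy N g i j k * f i j k) + gsum N (\<lambda>i j k. g i j k * Dy N f i j k)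
      = gsum N (\<lambda>i j k. (g i j k * f i (j + 1) k) / mesh N - (g i (j - 1) k * f i j k) / mesh N)"
    unfolding gsum_add[symmetric]
    by (intro arg_cong[where f = "gsum N"] ext) (simp add: dy_def Dy_def field_simps add_divide_distrib diff_divide_distrib)
  also have "\<dots> = 0"
    using gsum_shift(2)[of "\<lambda>i j k. (g i (j - 1) k * f i j k) / mesh N" N]
    by (simp add: gsum_diff C_perI C_perD[OF assms(1)] C_perD[OF assms(2)])
  finally show "gsum N (\<lambda>i j k. dy N g i j k * f i j k) = - gsum N (\<lambda>i j k. g i j k * Dy N f i j k)"
    by simp
  have "gsum N (\<lambda>i j k. dz N g i j k * f i j k) + gsum N (\<lambda>i j k. g i j k * Dz N f i j k)
      = gsum N (\<lambda>i j k. (g i j k * f i j (k + 1)) / mesh N - (g i j (k - 1) * f i j k) / mesh N)"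
    unfolding gsum_add[symmetric]
    by (intro arg_cong[where f = "gsum N"] ext) (simp add: dz_def Dz_def field_simps add_divide_distrib diff_divide_distrib)
  also have "\<dots> = 0"
    using gsum_shift(3)[of "\<lambda>i j k. (g i j (k - 1) * f i j k) / mesh N" N]
    by (simp add: gsum_diff C_perI C_perD[OF assms(1)] C_perD[OF assms(2)])
  finally show "gsum N (\<lambda>i j k. dz N g i j k * f i j k) = - gsum N (\<lambda>i j k. g i j k * Dz N f i j k)"
    by simp
qed

text \<open>The bilinear Dirichlet form belonging to \<open>- div_grad\<close>, with face weights
  and without the volume factor \<open>h^3\<close>.\<close>

definition dirichlet :: "nat \<Rightarrow> grid \<Rightarrow> grid \<Rightarrow> grid \<Rightarrow> grid \<Rightarrow> grid \<Rightarrow> real" where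
  "dirichlet N Mx My Mz f g = gsum N (\<lambda>i j k.
     Mx i j k * Dx N f i j k * Dx N g i j k +
     My i j k * Dy N f i j k * Dy N g i j k +
     Mz i j k * Dz N f i j k * Dz N g i j k)"

text \<open>Discrete Green formula: summation by parts for each of the three fluxes.\<close>

lemma gsum_div_grad:
  assumes "Mx \<in> C_per N" "My \<in> C_per N" "Mz \<in> C_per N" "f \<in> C_per N" "g \<in> C_per N"
  shows "gsum N (\<lambda>i j k. div_grad N Mx My Mz f i j k * g i j k) = - dirichlet N Mx My Mz f g"
proof -
  have P: "(\<lambda>i j k. Mx i j k * Dx N f i j k) \<in> C_per N"
    "(\<lambda>i j k. My i j k * Dy N f i j k) \<in> C_per N"
    "(\<lambda>i j k. Mz i j k * Dz N f i j k) \<in> C_per N"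
    by (intro C_perI; simp add: Dx_def Dy_def Dz_def assms(1-4)[THEN C_perD(1)] assms(1-4)[THEN C_perD(2)]
       assms(1-4)[THEN C_perD(3)] C_perD[OF assms(4)])+
  show ?thesis
    unfolding div_grad_def dirichlet_def distrib_right gsum_add
      gsum_by_parts(1)[OF assms(5) P(1)] gsum_by_parts(2)[OF assms(5) P(2)]
      gsum_by_parts(3)[OF assms(5) P(3)]
    by (simp add: minus_add)
qed

lemma div_grad_C_per:
  assumes "Mx \<in> C_per N" "My \<in> C_per N" "Mz \<in> C_per N" "f \<in> C_per N"
  shows "div_grad N Mx My Mz f \<in> C_per N"
  by (intro C_perI) (simp_all add: div_grad_def dx_def dy_def dz_def Dx_def Dy_def Dz_def
     C_perD[OF assms(1)] C_perD[OF assms(2)] C_perD[OF assms(3)] C_perD[OF assms(4)])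

lemma dirichlet_nonneg:
  assumes "\<And>i j k. Mx i j k \<ge> 0" "\<And>i j k. My i j k \<ge> 0" "\<And>i j k. Mz i j k \<ge> 0"
  shows "dirichlet N Mx My Mz f f \<ge> 0"
  unfolding dirichlet_def by (intro gsum_nonneg) (simp add: assms mult.assoc)

abbreviation "dirichlet1 N \<equiv> dirichlet N (\<lambda>i j k. 1) (\<lambda>i j k. 1) (\<lambda>i j k. 1)"

lemma dirichlet1_nonneg: "dirichlet1 N f f \<ge> 0"
  by (rule dirichlet_nonneg) auto

lemma laplace_eq_div_grad: "laplace N = div_grad N (\<lambda>i j k. 1) (\<lambda>i j k. 1) (\<lambda>i j k. 1)"
  by (intro ext) (simp add: laplace_def div_grad_def)

section \<open>Discrete Poincare inequality\<close>

lemma abs_diff_le_steps: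
  fixes f :: "int \<Rightarrow> real"
  assumes "\<And>i. \<bar>f (i + 1) - f i\<bar> \<le> \<delta>"
  shows "\<bar>f i - f i'\<bar> \<le> \<bar>real_of_int (i - i')\<bar> * \<delta>"
proof -
  have *: "\<bar>f (a + int n) - f a\<bar> \<le> real n * \<delta>" for a n
  proof (induction n)
    case (Suc n)
    thus ?case using assms[of "a + int n"] by (simp add: algebra_simps)
  qed simp
  show ?thesis
    using *[of i' "nat (i - i')"] *[of i "nat (i' - i)"]
    by (cases "i \<le> i'") (auto simp: abs_minus_commute)
qed

text \<open>Two points of one period are joined by at most \<open>3 * N\<close> unit steps along the
  axes, and each step changes \<open>f\<close> by at most the root of the Dirichlet energy.
  Comparing one value with all values of the period then leaves only the total sum to be controlled.
  The constant is crude.\<close>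

lemma abs_le_dirichlet1:
  assumes N: "N \<ge> 1" and f: "f \<in> C_per N"
  shows "\<bar>f i j k\<bar> \<le> (1 + 3 * real N ^ 4) * sqrt (dirichlet1 N f f + (gsum N f)\<^sup>2)"
proof -
  define S where "S = sqrt (dirichlet1 N f f + (gsum N f)\<^sup>2)"
  define \<delta> where "\<delta> = sqrt (dirichlet1 N f f)"
  have S: "\<delta> \<le> S" "\<bar>gsum N f\<bar> \<le> S" "0 \<le> \<delta>"
    using dirichlet1_nonneg[of N f] unfolding S_def \<delta>_def
    by (auto intro: real_le_rsqrt)
  have "(Dx N f i j k)\<^sup>2 + (Dy N f i j k)\<^sup>2 + (Dz N f i j k)\<^sup>2 \<le> dirichlet1 N f f" for i j k
  proof -
    have "(\<lambda>i j k. (Dx N f i j k)\<^sup>2 + (Dy N f i j k)\<^sup>2 + (Dz N f i j k)\<^sup>2) \<in> C_per N"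
      by (rule C_perI) (simp_all add: Dx_def Dy_def Dz_def C_perD[OF f])
    from le_gsum[OF N this, of i j k] show ?thesis
      by (simp add: dirichlet_def power2_eq_square)
  qed
  hence D: "(Dx N f i j k)\<^sup>2 \<le> dirichlet1 N f f" "(Dy N f i j k)\<^sup>2 \<le> dirichlet1 N f f"
      "(Dz N f i j k)\<^sup>2 \<le> dirichlet1 N f f" for i j k
    by (smt (verit) zero_le_power2)+
  \<comment> \<open>The difference quotient carries the factor \<open>1 / h = N\<close>, which is at
    least 1 and may be dropped.\<close>
  have m: "\<bar>x - y\<bar> \<le> \<delta>" if "((x - y) / mesh N)\<^sup>2 \<le> dirichlet1 N f f" for x y
  proof -
    have "real N * \<bar>x - y\<bar> \<le> \<delta>"
      using real_sqrt_le_mono[OF that] by (simp add: \<delta>_def mesh_def abs_mult mult.commute)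
    moreover have "1 * \<bar>x - y\<bar> \<le> real N * \<bar>x - y\<bar>" using N by (intro mult_right_mono) auto
    ultimately show ?thesis by simp
  qed
  have diff: "\<bar>f i j k - f i' j' k'\<bar> \<le> 3 * real N * \<delta>"
    if "i \<in> {1..int N}" "j \<in> {1..int N}" "k \<in> {1..int N}"
       "i' \<in> {1..int N}" "j' \<in> {1..int N}" "k' \<in> {1..int N}" for i j k i' j' k'
  proof -
    have "\<bar>f i j k - f i' j k\<bar> \<le> \<bar>real_of_int (i - i')\<bar> * \<delta>"
      by (rule abs_diff_le_steps[of "\<lambda>i. f i j k"]) (use D(1) m in \<open>simp add: Dx_def\<close>)
    also have "\<dots> \<le> real N * \<delta>" using that S(3) by (intro mult_right_mono) auto
    finally have 1: "\<bar>f i j k - f i' j k\<bar> \<le> real N * \<delta>" .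
    have "\<bar>f i' j k - f i' j' k\<bar> \<le> \<bar>real_of_int (j - j')\<bar> * \<delta>"
      by (rule abs_diff_le_steps[of "\<lambda>j. f i' j k"]) (use D(2) m in \<open>simp add: Dy_def\<close>)
    also have "\<dots> \<le> real N * \<delta>" using that S(3) by (intro mult_right_mono) auto
    finally have 2: "\<bar>f i' j k - f i' j' k\<bar> \<le> real N * \<delta>" .
    have "\<bar>f i' j' k - f i' j' k'\<bar> \<le> \<bar>real_of_int (k - k')\<bar> * \<delta>"
      by (rule abs_diff_le_steps[of "\<lambda>k. f i' j' k"]) (use D(3) m in \<open>simp add: Dz_def\<close>)
    also have "\<dots> \<le> real N * \<delta>" using that S(3) by (intro mult_right_mono) auto
    finally show ?thesis using 1 2 by linarith
  qed
  define x where "x = f i j k"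
  have "\<bar>x - f i' j' k'\<bar> \<le> 3 * real N * \<delta>" for i' j' k'
    using diff[OF rep_in[OF N] rep_in[OF N] rep_in[OF N] rep_in[OF N] rep_in[OF N] rep_in[OF N], of i j k i' j' k']
    by (simp add: C_per_rep[OF f] x_def)
  \<comment> \<open>Summing over the second point turns the oscillation bound into a bound on
    \<open>N^3 * x - gsum N f\<close>.\<close>
  hence "gsum N (\<lambda>i' j' k'. \<bar>x - f i' j' k'\<bar>) \<le> real N ^ 3 * (3 * real N * \<delta>)"
    using gsum_mono[of "\<lambda>i' j' k'. \<bar>x - f i' j' k'\<bar>" "\<lambda>_ _ _. 3 * real N * \<delta>" N]
    by (simp add: gsum_const)
  hence "\<bar>real N ^ 3 * x - gsum N f\<bar> \<le> 3 * real N ^ 4 * \<delta>"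
    using abs_gsum_le[of N "\<lambda>i' j' k'. x - f i' j' k'"]
    by (simp add: gsum_diff gsum_const power_numeral_reduce algebra_simps)
  also have "\<dots> \<le> 3 * real N ^ 4 * S" using S by (intro mult_left_mono) auto
  finally have "real N ^ 3 * \<bar>x\<bar> \<le> (1 + 3 * real N ^ 4) * S"
    using S(2) abs_mult[of "real N ^ 3" x] by (simp add: algebra_simps)
  moreover have "1 * \<bar>x\<bar> \<le> real N ^ 3 * \<bar>x\<bar>" using N by (intro mult_right_mono) auto
  ultimately show ?thesis by (simp add: x_def S_def)
qed

section \<open>The discrete Laplacian and its inverse\<close>

lemma C_per_minus: "f \<in> C_per N \<Longrightarrow> g \<in> C_per N \<Longrightarrow> (\<lambda>i j k. f i j k - g i j k) \<in> C_per N"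
  and C_per_plus: "f \<in> C_per N \<Longrightarrow> g \<in> C_per N \<Longrightarrow> (\<lambda>i j k. f i j k + g i j k) \<in> C_per N"
  by (rule C_per_map2; assumption)+

lemma div_grad_diff:
  "div_grad N Mx My Mz (\<lambda>i j k. f i j k - g i j k) i j k
     = div_grad N Mx My Mz f i j k - div_grad N Mx My Mz g i j k"
  by (simp add: div_grad_def dx_def dy_def dz_def Dx_def Dy_def Dz_def mesh_def algebra_simps)

lemma div_grad_minus:
  "div_grad N Mx My Mz (\<lambda>i j k. - f i j k) i j k = - div_grad N Mx My Mz f i j k"
  by (simp add: div_grad_def dx_def dy_def dz_def Dx_def Dy_def Dz_def mesh_def algebra_simps)

lemma laplace_diff: "laplace N (\<lambda>i j k. f i j k - g i j k) i j k = laplace N f i j k - laplace N g i j k"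
  and laplace_minus: "laplace N (\<lambda>i j k. - f i j k) i j k = - laplace N f i j k"
  by (simp_all add: laplace_eq_div_grad div_grad_diff div_grad_minus)

lemma gsum_laplace:
  assumes "f \<in> C_per N" "g \<in> C_per N"
  shows "gsum N (\<lambda>i j k. laplace N f i j k * g i j k) = - dirichlet1 N f g"
  unfolding laplace_eq_div_grad by (rule gsum_div_grad) (use assms in auto)

text \<open>\<open>w\<close> is itself an admissible test function, so the sum of its squares
  vanishes.\<close>

lemma grid_eq_0I:
  assumes N: "N \<ge> 1" and w: "w \<in> C_per N"
    and orth: "\<And>\<alpha>. \<alpha> \<in> C_per N \<Longrightarrow> gsum N (\<lambda>i j k. w i j k * \<alpha> i j k) = 0"
  shows "w i j k = 0"
proof -
  have "w i j k * w i j k = 0"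
    by (rule gsum_eq_0D[OF N, of "\<lambda>i j k. w i j k * w i j k"])
       (use orth[OF w] C_per_map[OF w, of "\<lambda>x. x * x"] in auto)
  thus ?thesis by simp
qed

lemma laplace_eq_0D:
  assumes "N \<ge> 1" "f \<in> C_per N" "gsum N f = 0" "\<And>i j k. laplace N f i j k = 0"
  shows "f i j k = 0"
proof -
  have "dirichlet1 N f f = 0"
    using gsum_laplace[OF assms(2,2)] by (simp add: assms(4) gsum_const)
  thus ?thesis using abs_le_dirichlet1[OF assms(1,2), of i j k] assms(3) by simp
qed

text \<open>Uniqueness follows from the trivial kernel of the Laplacian on functions of mean zero.
  Existence is supplied by the given \<open>\<psi>\<close>, so the definite description can be
  evaluated before Poisson's equation is known to be solvable in general.\<close>

lemma inv_neg_laplace_eqI: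
  assumes N: "N \<ge> 1" and \<psi>: "\<psi> \<in> C_per N" "gsum N \<psi> = 0"
    and eq: "\<And>i j k. - laplace N \<psi> i j k = f i j k"
  shows "inv_neg_laplace N f = \<psi>"
  unfolding inv_neg_laplace_def
proof (rule the_equality)
  show "\<psi> \<in> C0_per N \<and> - laplace N \<psi> = f"
    using \<psi> eq by (auto simp: C0_per_def grid_mean_eq_0_iff[OF N] fun_eq_iff)
next
  fix \<phi> assume \<phi>: "\<phi> \<in> C0_per N \<and> - laplace N \<phi> = f"
  hence "- laplace N \<phi> i j k = f i j k" for i j k by auto
  hence "laplace N (\<lambda>i j k. \<phi> i j k - \<psi> i j k) i j k = 0" for i j k
    unfolding laplace_diff using eq[of i j k] by (metis eq_iff_diff_eq_0 neg_equal_iff_equal)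
  moreover have "gsum N (\<lambda>i j k. \<phi> i j k - \<psi> i j k) = 0" "\<phi> \<in> C_per N"
    using \<phi> \<psi> by (auto simp: C0_per_def grid_mean_eq_0_iff[OF N] gsum_diff)
  ultimately have "\<phi> i j k - \<psi> i j k = 0" for i j k
    using laplace_eq_0D[OF N, of "\<lambda>i j k. \<phi> i j k - \<psi> i j k"] C_per_minus \<psi>(1) by blast
  thus "\<phi> = \<psi>" by (auto simp: fun_eq_iff)
qed

section \<open>Compactness, continuity and derivatives\<close>

lemma compact_fun_box:
  fixes S :: "'b::topological_space set"
  assumes "compact S"
  shows "compact {f :: 'a \<Rightarrow> 'b. \<forall>i. f i \<in> S}"
proof -
  have "compactin (product_topology (\<lambda>i::'a. euclidean) UNIV) (PiE UNIV (\<lambda>i. S))"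
    using assms by (simp add: compactin_PiE)
  moreover have "PiE UNIV (\<lambda>i::'a. S) = {f. \<forall>i. f i \<in> S}" by auto
  ultimately show ?thesis by (simp add: euclidean_product_topology)
qed

lemma continuous_on_grid_eval:
  fixes f :: "'a::topological_space \<Rightarrow> grid"
  assumes "continuous_on S f"
  shows "continuous_on S (\<lambda>x. f x i j k)"
  by (rule assms[THEN continuous_on_product_then_coordinatewise,
        THEN continuous_on_product_then_coordinatewise, THEN continuous_on_product_then_coordinatewise])

definition grid_box :: "nat \<Rightarrow> real \<Rightarrow> grid set" where
  "grid_box N R = {f \<in> C_per N. \<forall>i j k. \<bar>f i j k\<bar> \<le> R}"

text \<open>Tychonoff's theorem, once for each of the three indices, gives a compact box in the
  product topology, and periodicity is a closed condition on point values.\<close>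

lemma compact_grid_box: "compact (grid_box N R)"
proof -
  have "compact {f::grid. \<forall>i. f i \<in> {g. \<forall>j. g j \<in> {h. \<forall>k. h k \<in> {-R..R}}}}"
    by (intro compact_fun_box) simp
  moreover have "closed (C_per N)"
    unfolding C_per_def
    by (intro closed_Collect_all closed_Collect_conj closed_Collect_eq
          continuous_on_grid_eval[OF continuous_on_id])
  moreover have "grid_box N R = {f. \<forall>i. f i \<in> {g. \<forall>j. g j \<in> {h. \<forall>k. h k \<in> {-R..R}}}} \<inter> C_per N"
    by (auto simp: grid_box_def abs_le_iff minus_le_iff[of R])
  ultimately show ?thesis by (simp add: compact_Int_closed)
qed

lemma continuous_on_gsum:
  "(\<And>i j k. continuous_on S (\<lambda>x. f x i j k)) \<Longrightarrow> continuous_on S (\<lambda>x. gsum N (f x))"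
  unfolding gsum_def by (intro continuous_intros)

lemma continuous_on_dirichlet:
  assumes f: "continuous_on S f"
  shows "continuous_on S (\<lambda>x. dirichlet N Mx My Mz (f x) (f x))"
  unfolding dirichlet_def Dx_def Dy_def Dz_def divide_inverse
  by (intro continuous_on_gsum continuous_on_add continuous_on_mult continuous_on_diff
        continuous_on_const continuous_on_grid_eval[OF f])

lemma DERIV_gsum:
  "(\<And>i j k. ((\<lambda>t. f t i j k) has_real_derivative f' i j k) (at x)) \<Longrightarrow>
     ((\<lambda>t. gsum N (f t)) has_real_derivative gsum N f') (at x)"
  unfolding gsum_def by (intro DERIV_sum)

lemma DERIV_dirichlet:
  "((\<lambda>t. dirichlet N Mx My Mz (\<lambda>i j k. f i j k + t * g i j k) (\<lambda>i j k. f i j k + t * g i j k))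
     has_real_derivative 2 * dirichlet N Mx My Mz f g) (at 0)"
proof -
  have D: "Dx N (\<lambda>i j k. f i j k + t * g i j k) i j k = Dx N f i j k + t * Dx N g i j k"
    "Dy N (\<lambda>i j k. f i j k + t * g i j k) i j k = Dy N f i j k + t * Dy N g i j k"
    "Dz N (\<lambda>i j k. f i j k + t * g i j k) i j k = Dz N f i j k + t * Dz N g i j k" for t i j k
    by (simp_all add: Dx_def Dy_def Dz_def mesh_def algebra_simps)
  show ?thesis
    unfolding dirichlet_def D gsum_cmult[symmetric]
    by (rule DERIV_gsum) (auto intro!: derivative_eq_intros simp: algebra_simps)
qed

section \<open>Coercivity of the functional\<close>

lemma cell_energy_gsum_coercive:
  assumes N: "N \<ge> 1" and \<tau>: "\<tau> > 0" and n: "n \<in> C_per N" "\<And>i j k. n i j k > 0"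
  shows "\<exists>e>0. \<exists>C. \<forall>a\<in>C_per N. \<forall>i j k.
    e * \<bar>a i j k\<bar> - C \<le> gsum N (\<lambda>i j k. cell_energy \<tau> (n i j k) (a i j k) - n i j k * a i j k)"
proof -
  obtain e C where e: "\<And>r. r > 0 \<Longrightarrow> e r > 0"
    and eC: "\<And>r s. r > 0 \<Longrightarrow> e r * \<bar>s\<bar> - C r \<le> cell_energy \<tau> r s - r * s"
    using cell_energy_coercive[OF \<tau>] by metis
  \<comment> \<open>The slope \<open>e\<close> depends on the density of the cell. \<open>T\<close>
    dominates all reciprocals \<open>1 / e\<close>, so \<open>1 / T\<close> is one positive slope
    valid in every cell.\<close>
  define T where "T = gsum N (\<lambda>i j k. 1 / e (n i j k))"
  have T1: "1 / e (n i j k) \<le> T" for i j k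
    unfolding T_def
    by (rule le_gsum[OF N, of "\<lambda>i j k. 1 / e (n i j k)"])
       (use C_per_map[OF n(1), of "\<lambda>x. 1 / e x"] e n(2) in \<open>auto simp: less_imp_le\<close>)
  have T: "T > 0" using T1[of 0 0 0] e[OF n(2)[of 0 0 0]] by (smt (verit) zero_less_divide_1_iff)
  have "1 / T * \<bar>a i j k\<bar> - gsum N (\<lambda>i j k. C (n i j k))
      \<le> gsum N (\<lambda>i j k. cell_energy \<tau> (n i j k) (a i j k) - n i j k * a i j k)"
    if a: "a \<in> C_per N" for a i j k
  proof -
    \<comment> \<open>Adding the constants \<open>C\<close> makes every summand nonnegative, so that
      a single one is bounded by the total.\<close>
    let ?h = "\<lambda>i j k. cell_energy \<tau> (n i j k) (a i j k) - n i j k * a i j k + C (n i j k)"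
    have h: "e (n i j k) * \<bar>a i j k\<bar> \<le> ?h i j k" for i j k
      using eC[OF n(2)[of i j k], of "a i j k"] by simp
    have "0 \<le> e (n i j k) * \<bar>a i j k\<bar>" for i j k
      using e[OF n(2)[of i j k]] by simp
    hence h0: "0 \<le> ?h i j k" for i j k
      using h order_trans by blast
    have "1 / T \<le> e (n i j k)"
      using T1[of i j k] T e[OF n(2)[of i j k]] by (simp add: field_simps)
    hence "1 / T * \<bar>a i j k\<bar> \<le> e (n i j k) * \<bar>a i j k\<bar>" by (intro mult_right_mono) auto
    also have "\<dots> \<le> ?h i j k" by (rule h)
    also have "?h i j k \<le> gsum N ?h"
      by (rule le_gsum[OF N _ h0])
         (rule C_per_map2[OF n(1) a, of "\<lambda>x y. cell_energy \<tau> x y - x * y + C x"])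
    finally show ?thesis by (simp add: gsum_add)
  qed
  moreover have "1 / T > 0" using T by simp
  ultimately show ?thesis by blast
qed

lemma dirichlet1_coercive:
  assumes N: "N \<ge> 1" and f: "f \<in> C_per N"
  shows "\<exists>e>0. \<exists>C. \<forall>\<psi>\<in>C_per N. \<forall>i j k.
    e * \<bar>\<psi> i j k\<bar> - C \<le> dirichlet1 N \<psi> \<psi> + (gsum N \<psi>)\<^sup>2 - 2 * gsum N (\<lambda>i j k. f i j k * \<psi> i j k)"
proof -
  define K where "K = 1 + 3 * real N ^ 4"
  define A where "A = gsum N (\<lambda>i j k. \<bar>f i j k\<bar>)"
  \<comment> \<open>With this \<open>B\<close>, \<open>S^2 - 2 * A * K * S - S + B^2 / 4\<close> is
    the square of \<open>S - B / 2\<close>. The quadratic part thus beats the load term with a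
    linear gain left over.\<close>
  define B where "B = 2 * (A * K) + 1"
  have K: "K > 0" by (simp add: K_def add_pos_nonneg)
  have "1 / K * \<bar>\<psi> i j k\<bar> - B\<^sup>2 / 4
      \<le> dirichlet1 N \<psi> \<psi> + (gsum N \<psi>)\<^sup>2 - 2 * gsum N (\<lambda>i j k. f i j k * \<psi> i j k)"
    if \<psi>: "\<psi> \<in> C_per N" for \<psi> i j k
  proof -
    define S where "S = sqrt (dirichlet1 N \<psi> \<psi> + (gsum N \<psi>)\<^sup>2)"
    have S2: "S\<^sup>2 = dirichlet1 N \<psi> \<psi> + (gsum N \<psi>)\<^sup>2"
      using dirichlet1_nonneg[of N \<psi>] by (simp add: S_def)
    have \<psi>S: "\<bar>\<psi> i j k\<bar> \<le> K * S" for i j k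
      using abs_le_dirichlet1[OF N \<psi>] by (simp add: K_def S_def)
    have "gsum N (\<lambda>i j k. f i j k * \<psi> i j k) \<le> gsum N (\<lambda>i j k. (K * S) * \<bar>f i j k\<bar>)"
    proof (rule gsum_mono)
      fix i j k
      have "f i j k * \<psi> i j k \<le> \<bar>f i j k\<bar> * \<bar>\<psi> i j k\<bar>" by (metis abs_ge_self abs_mult)
      also have "\<dots> \<le> \<bar>f i j k\<bar> * (K * S)" using \<psi>S by (intro mult_left_mono) auto
      finally show "f i j k * \<psi> i j k \<le> (K * S) * \<bar>f i j k\<bar>" by (simp add: mult.commute)
    qed
    also have "\<dots> = A * K * S" by (simp add: gsum_cmult A_def)
    finally have "S\<^sup>2 - 2 * (A * K * S)
      \<le> dirichlet1 N \<psi> \<psi> + (gsum N \<psi>)\<^sup>2 - 2 * gsum N (\<lambda>i j k. f i j k * \<psi> i j k)"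
      unfolding S2 by linarith
    moreover have "S - B\<^sup>2 / 4 \<le> S\<^sup>2 - 2 * (A * K * S)"
      using zero_le_power2[of "S - B / 2"] by (simp add: B_def power2_eq_square field_simps)
    moreover have "1 / K * \<bar>\<psi> i j k\<bar> \<le> S"
      using \<psi>S[of i j k] K by (simp add: field_simps)
    ultimately show ?thesis by linarith
  qed
  moreover have "1 / K > 0" using K by simp
  ultimately show ?thesis by blast
qed

section \<open>The coupled system\<close>

locale two_species =
  fixes N :: nat and \<tau> :: real and n p Mx My Mz Px Py Pz :: grid
  assumes N: "N \<ge> 1" and \<tau>: "\<tau> > 0"
    and per: "n \<in> C_per N" "p \<in> C_per N"
      "Mx \<in> C_per N" "My \<in> C_per N" "Mz \<in> C_per N"
      "Px \<in> C_per N" "Py \<in> C_per N" "Pz \<in> C_per N"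
    and pos: "\<And>i j k. n i j k > 0" "\<And>i j k. p i j k > 0"
    and nonneg: "\<And>i j k. Mx i j k \<ge> 0" "\<And>i j k. My i j k \<ge> 0" "\<And>i j k. Mz i j k \<ge> 0"
      "\<And>i j k. Px i j k \<ge> 0" "\<And>i j k. Py i j k \<ge> 0" "\<And>i j k. Pz i j k \<ge> 0"
    and neutral: "gsum N n = gsum N p"
begin

section \<open>Existence of a minimiser\<close>

definition energy :: "grid \<times> grid \<times> grid \<Rightarrow> real" where
  "energy = (\<lambda>(a, b, \<psi>).
     gsum N (\<lambda>i j k. cell_energy \<tau> (n i j k) (a i j k) - n i j k * a i j k) +
     gsum N (\<lambda>i j k. cell_energy \<tau> (p i j k) (b i j k) - p i j k * b i j k) +
     (dirichlet1 N \<psi> \<psi> + (gsum N \<psi>)\<^sup>2 - 2 * gsum N (\<lambda>i j k. (n i j k - p i j k) * \<psi> i j k)) +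
     \<tau> / 2 * dirichlet N Mx My Mz (\<lambda>i j k. a i j k + \<psi> i j k) (\<lambda>i j k. a i j k + \<psi> i j k) +
     \<tau> / 2 * dirichlet N Px Py Pz (\<lambda>i j k. b i j k - \<psi> i j k) (\<lambda>i j k. b i j k - \<psi> i j k))"

lemma continuous_on_energy: "continuous_on S energy"
proof -
  have E: "continuous_on S (\<lambda>x. cell_energy \<tau> r (f x))" if "r > 0" "continuous_on S f"
    for r and f :: "grid \<times> grid \<times> grid \<Rightarrow> real"
    by (rule continuous_on_compose2[of UNIV "cell_energy \<tau> r", OF _ that(2)])
       (use DERIV_cell_energy[OF \<tau> that(1)] DERIV_isCont in
         \<open>auto intro!: continuous_at_imp_continuous_on\<close>)
  have eval: "continuous_on S (\<lambda>x::grid \<times> grid \<times> grid. fst x i j k)"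
    "continuous_on S (\<lambda>x::grid \<times> grid \<times> grid. fst (snd x) i j k)"
    "continuous_on S (\<lambda>x::grid \<times> grid \<times> grid. snd (snd x) i j k)" for i j k
    by (rule continuous_on_grid_eval, intro continuous_on_fst continuous_on_snd continuous_on_id)+
  have Q: "continuous_on S (\<lambda>x. dirichlet N Kx Ky Kz (f x) (f x))"
    if "\<And>i j k. continuous_on S (\<lambda>x. f x i j k)"
    for Kx Ky Kz and f :: "grid \<times> grid \<times> grid \<Rightarrow> grid"
    by (intro continuous_on_dirichlet continuous_on_coordinatewise_then_product that)
  show ?thesis
    unfolding energy_def case_prod_unfold
    by (intro continuous_on_add continuous_on_diff continuous_on_mult continuous_on_power
          continuous_on_gsum Q E pos continuous_on_const eval)
qed

text \<open>Direct method: by coercivity every triple whose energy is at most that of zero lies in a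
  fixed compact box, where the continuous functional attains its minimum.\<close>

lemma energy_attains_min:
  obtains a b \<psi> where "a \<in> C_per N" "b \<in> C_per N" "\<psi> \<in> C_per N"
    and "\<And>a' b' \<psi>'. \<lbrakk>a' \<in> C_per N; b' \<in> C_per N; \<psi>' \<in> C_per N\<rbrakk> \<Longrightarrow> energy (a, b, \<psi>) \<le> energy (a', b', \<psi>')"
proof -
  have np: "(\<lambda>i j k. n i j k - p i j k) \<in> C_per N" using per by (intro C_per_minus)
  obtain e1 C1 where 1: "e1 > 0" "\<And>a i j k. a \<in> C_per N \<Longrightarrow> e1 * \<bar>a i j k\<bar> - C1
      \<le> gsum N (\<lambda>i j k. cell_energy \<tau> (n i j k) (a i j k) - n i j k * a i j k)"
    using cell_energy_gsum_coercive[OF N \<tau> per(1) pos(1)] by blast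
  obtain e2 C2 where 2: "e2 > 0" "\<And>a i j k. a \<in> C_per N \<Longrightarrow> e2 * \<bar>a i j k\<bar> - C2
      \<le> gsum N (\<lambda>i j k. cell_energy \<tau> (p i j k) (a i j k) - p i j k * a i j k)"
    using cell_energy_gsum_coercive[OF N \<tau> per(2) pos(2)] by blast
  obtain e3 C3 where 3: "e3 > 0" "\<And>\<psi> i j k. \<psi> \<in> C_per N \<Longrightarrow> e3 * \<bar>\<psi> i j k\<bar> - C3
      \<le> dirichlet1 N \<psi> \<psi> + (gsum N \<psi>)\<^sup>2 - 2 * gsum N (\<lambda>i j k. (n i j k - p i j k) * \<psi> i j k)"
    using dirichlet1_coercive[OF N np] by blast
  define z :: grid where "z = (\<lambda>i j k. 0)"
  have z: "z \<in> C_per N" by (simp add: z_def)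
  define B where "B = energy (z, z, z) + C1 + C2 + C3"
  have bound: "e1 * \<bar>a i j k\<bar> \<le> B \<and> e2 * \<bar>b i j k\<bar> \<le> B \<and> e3 * \<bar>\<psi> i j k\<bar> \<le> B"
    if "a \<in> C_per N" "b \<in> C_per N" "\<psi> \<in> C_per N" "energy (a, b, \<psi>) \<le> energy (z, z, z)" for a b \<psi> i j k
  proof -
    have "0 \<le> \<tau> / 2 * dirichlet N Mx My Mz (\<lambda>i j k. a i j k + \<psi> i j k) (\<lambda>i j k. a i j k + \<psi> i j k)"
      "0 \<le> \<tau> / 2 * dirichlet N Px Py Pz (\<lambda>i j k. b i j k - \<psi> i j k) (\<lambda>i j k. b i j k - \<psi> i j k)"
      using \<tau> nonneg by (auto intro!: mult_nonneg_nonneg dirichlet_nonneg)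
    hence "e1 * \<bar>a i j k\<bar> - C1 + (e2 * \<bar>b i j k\<bar> - C2) + (e3 * \<bar>\<psi> i j k\<bar> - C3) \<le> energy (a, b, \<psi>)"
      using 1(2)[OF that(1), of i j k] 2(2)[OF that(2), of i j k] 3(2)[OF that(3), of i j k]
      unfolding energy_def by simp
    moreover have "0 \<le> e1 * \<bar>a i j k\<bar>" "0 \<le> e2 * \<bar>b i j k\<bar>" "0 \<le> e3 * \<bar>\<psi> i j k\<bar>"
      using 1 2 3 by auto
    ultimately show ?thesis using that(4) unfolding B_def by linarith
  qed
  define R where "R = \<bar>B\<bar> / e1 + \<bar>B\<bar> / e2 + \<bar>B\<bar> / e3"
  have R: "x \<le> R" if "e * x \<le> B" "e \<in> {e1, e2, e3}" for x e
  proof -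
    have "x \<le> \<bar>B\<bar> / e" using that 1(1) 2(1) 3(1) by (auto simp: field_simps)
    also have "\<dots> \<le> R" unfolding R_def using that(2) 1(1) 2(1) 3(1) by auto
    finally show ?thesis .
  qed
  have "R \<ge> 0" unfolding R_def using 1(1) 2(1) 3(1) by simp
  define X where "X = grid_box N R \<times> grid_box N R \<times> grid_box N R"
  have zX: "(z, z, z) \<in> X" using z \<open>R \<ge> 0\<close> by (simp add: X_def grid_box_def z_def)
  have "compact X" unfolding X_def by (intro compact_Times compact_grid_box)
  then obtain m where m: "m \<in> X" "\<And>y. y \<in> X \<Longrightarrow> energy m \<le> energy y"
    using continuous_attains_inf[of X energy] continuous_on_energy zX by blast
  obtain a b \<psi> where abc: "m = (a, b, \<psi>)" by (cases m)
  show thesis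
  proof
    show "a \<in> C_per N" "b \<in> C_per N" "\<psi> \<in> C_per N"
      using m(1) by (auto simp: X_def abc grid_box_def)
    fix a' b' \<psi>' assume C: "a' \<in> C_per N" "b' \<in> C_per N" "\<psi>' \<in> C_per N"
    show "energy (a, b, \<psi>) \<le> energy (a', b', \<psi>')"
    proof (cases "energy (a', b', \<psi>') \<le> energy (z, z, z)")
      case True
      have "\<bar>a' i j k\<bar> \<le> R" "\<bar>b' i j k\<bar> \<le> R" "\<bar>\<psi>' i j k\<bar> \<le> R" for i j k
        using bound[OF C True, of i j k] by (auto intro: R[of e1] R[of e2] R[of e3])
      hence "(a', b', \<psi>') \<in> X"
        using C by (simp add: X_def grid_box_def)
      thus ?thesis using m(2) abc by blast
    next
      \<comment> \<open>A competitor with more energy than zero may lie outside the box, but it is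
        beaten by zero, which lies inside.\<close>
      case False
      thus ?thesis using m(2)[OF zX] abc by simp
    qed
  qed
qed

section \<open>First variation and Euler-Lagrange equations\<close>

lemma DERIV_energy:
  "((\<lambda>t. energy (\<lambda>i j k. a i j k + t * \<alpha> i j k, \<lambda>i j k. b i j k + t * \<beta> i j k,
                 \<lambda>i j k. \<psi> i j k + t * \<kappa> i j k)) has_real_derivative
     gsum N (\<lambda>i j k. (cell_resp \<tau> (n i j k) (a i j k) - n i j k) * \<alpha> i j k) +
     gsum N (\<lambda>i j k. (cell_resp \<tau> (p i j k) (b i j k) - p i j k) * \<beta> i j k) +
     (2 * dirichlet1 N \<psi> \<kappa> + 2 * gsum N \<psi> * gsum N \<kappa>
        - 2 * gsum N (\<lambda>i j k. (n i j k - p i j k) * \<kappa> i j k)) +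
     \<tau> * dirichlet N Mx My Mz (\<lambda>i j k. a i j k + \<psi> i j k) (\<lambda>i j k. \<alpha> i j k + \<kappa> i j k) +
     \<tau> * dirichlet N Px Py Pz (\<lambda>i j k. b i j k - \<psi> i j k) (\<lambda>i j k. \<beta> i j k - \<kappa> i j k)) (at 0)"
proof -
  have E: "((\<lambda>t. gsum N (\<lambda>i j k. cell_energy \<tau> (q i j k) (f i j k + t * g i j k) - q i j k * (f i j k + t * g i j k)))
      has_real_derivative gsum N (\<lambda>i j k. (cell_resp \<tau> (q i j k) (f i j k) - q i j k) * g i j k)) (at 0)"
    if q: "\<And>i j k. q i j k > 0" for q f g :: grid
  proof (rule DERIV_gsum)
    fix i j k
    have "((\<lambda>t. cell_energy \<tau> (q i j k) (f i j k + t * g i j k)) has_real_derivative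
        cell_resp \<tau> (q i j k) (f i j k + 0 * g i j k) * g i j k) (at 0)"
      by (rule DERIV_chain2[OF DERIV_cell_energy[OF \<tau> q]]) (auto intro!: derivative_eq_intros)
    thus "((\<lambda>t. cell_energy \<tau> (q i j k) (f i j k + t * g i j k) - q i j k * (f i j k + t * g i j k))
      has_real_derivative (cell_resp \<tau> (q i j k) (f i j k) - q i j k) * g i j k) (at 0)"
      by (auto intro!: derivative_eq_intros simp: algebra_simps)
  qed
  have G: "((\<lambda>t. gsum N (\<lambda>i j k. \<psi> i j k + t * \<kappa> i j k)) has_real_derivative gsum N \<kappa>) (at 0)"
    by (rule DERIV_gsum) (auto intro!: derivative_eq_intros)
  have L: "((\<lambda>t. gsum N (\<lambda>i j k. (n i j k - p i j k) * (\<psi> i j k + t * \<kappa> i j k))) has_real_derivative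
      gsum N (\<lambda>i j k. (n i j k - p i j k) * \<kappa> i j k)) (at 0)"
    by (rule DERIV_gsum) (auto intro!: derivative_eq_intros)
  have eq: "(\<lambda>i j k. a i j k + t * \<alpha> i j k + (\<psi> i j k + t * \<kappa> i j k))
      = (\<lambda>i j k. (a i j k + \<psi> i j k) + t * (\<alpha> i j k + \<kappa> i j k))"
    "(\<lambda>i j k. b i j k + t * \<beta> i j k - (\<psi> i j k + t * \<kappa> i j k))
      = (\<lambda>i j k. (b i j k - \<psi> i j k) + t * (\<beta> i j k - \<kappa> i j k))" for t
    by (simp_all add: algebra_simps)
  note der = E[of n a \<alpha>, OF pos(1)] E[of p b \<beta>, OF pos(2)] G L DERIV_dirichlet
  show ?thesis
    unfolding energy_def case_prod_conv eq
    by (rule derivative_eq_intros der refl | simp)+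
qed

text \<open>Varying \<open>a\<close> and \<open>b\<close> separately gives the two transport
  equations. Poisson's equation comes from a joint variation that does not see the mobility terms,
  and constant test functions give the vanishing sum of \<open>\<psi>\<close>.\<close>

lemma euler_lagrange:
  obtains a b \<psi> where "a \<in> C_per N" "b \<in> C_per N" "\<psi> \<in> C_per N" "gsum N \<psi> = 0"
    and "\<And>i j k. cell_resp \<tau> (n i j k) (a i j k) - n i j k
           = \<tau> * div_grad N Mx My Mz (\<lambda>i j k. a i j k + \<psi> i j k) i j k"
    and "\<And>i j k. cell_resp \<tau> (p i j k) (b i j k) - p i j k
           = \<tau> * div_grad N Px Py Pz (\<lambda>i j k. b i j k - \<psi> i j k) i j k"
    and "\<And>i j k. - laplace N \<psi> i j k = (cell_resp \<tau> (n i j k) (a i j k) + n i j k) / 2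
           - (cell_resp \<tau> (p i j k) (b i j k) + p i j k) / 2"
proof -
  obtain a b \<psi> where abc: "a \<in> C_per N" "b \<in> C_per N" "\<psi> \<in> C_per N"
    and min: "\<And>a' b' \<psi>'. \<lbrakk>a' \<in> C_per N; b' \<in> C_per N; \<psi>' \<in> C_per N\<rbrakk> \<Longrightarrow> energy (a, b, \<psi>) \<le> energy (a', b', \<psi>')"
    using energy_attains_min by blast
  define u v where "u = (\<lambda>i j k. cell_resp \<tau> (n i j k) (a i j k))"
    and "v = (\<lambda>i j k. cell_resp \<tau> (p i j k) (b i j k))"
  define \<mu> \<nu> where "\<mu> = (\<lambda>i j k. a i j k + \<psi> i j k)" and "\<nu> = (\<lambda>i j k. b i j k - \<psi> i j k)"
  have per': "u \<in> C_per N" "v \<in> C_per N" "\<mu> \<in> C_per N" "\<nu> \<in> C_per N"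
    unfolding u_def v_def \<mu>_def \<nu>_def by (rule C_per_map2[OF per(1) abc(1)] C_per_map2[OF per(2) abc(2)]
        C_per_map2[OF abc(1,3)] C_per_map2[OF abc(2,3)])+
  have stat: "gsum N (\<lambda>i j k. (u i j k - n i j k) * \<alpha> i j k) +
     gsum N (\<lambda>i j k. (v i j k - p i j k) * \<beta> i j k) +
     (2 * dirichlet1 N \<psi> \<kappa> + 2 * gsum N \<psi> * gsum N \<kappa>
        - 2 * gsum N (\<lambda>i j k. (n i j k - p i j k) * \<kappa> i j k)) +
     \<tau> * dirichlet N Mx My Mz \<mu> (\<lambda>i j k. \<alpha> i j k + \<kappa> i j k) +
     \<tau> * dirichlet N Px Py Pz \<nu> (\<lambda>i j k. \<beta> i j k - \<kappa> i j k) = 0"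
    if "\<alpha> \<in> C_per N" "\<beta> \<in> C_per N" "\<kappa> \<in> C_per N" for \<alpha> \<beta> \<kappa>
  proof -
    have *: "(\<lambda>i j k. f i j k + t * g i j k) \<in> C_per N" if "f \<in> C_per N" "g \<in> C_per N" for t f g
      by (rule C_per_map2[OF that])
    show ?thesis
      unfolding u_def v_def \<mu>_def \<nu>_def
      by (rule DERIV_local_min[OF DERIV_energy zero_less_one])
         (use that abc in \<open>auto intro!: min *\<close>)
  qed
  have zero: "dirichlet N Kx Ky Kz f (\<lambda>i j k. 0) = 0" for Kx Ky Kz f
    by (simp add: dirichlet_def Dx_def Dy_def Dz_def gsum_const)
  have z: "(\<lambda>i j k. 0) \<in> C_per N" by simp
  define w1 where "w1 = (\<lambda>i j k. u i j k - n i j k - \<tau> * div_grad N Mx My Mz \<mu> i j k)"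
  define w2 where "w2 = (\<lambda>i j k. v i j k - p i j k - \<tau> * div_grad N Px Py Pz \<nu> i j k)"
  have orth1: "gsum N (\<lambda>i j k. w1 i j k * \<alpha> i j k) = 0" if "\<alpha> \<in> C_per N" for \<alpha>
    using stat[OF that z z] gsum_div_grad[OF per(3,4,5) per'(3) that]
    by (simp add: w1_def zero gsum_const left_diff_distrib gsum_diff gsum_cmult mult.assoc)
  have w1: "w1 i j k = 0" for i j k
  proof (rule grid_eq_0I[OF N _ orth1])
    show "w1 \<in> C_per N" unfolding w1_def
      by (intro C_per_minus per' per C_per_map[of _ _ "\<lambda>x. \<tau> * x"] div_grad_C_per)
  qed
  have orth2: "gsum N (\<lambda>i j k. w2 i j k * \<alpha> i j k) = 0" if "\<alpha> \<in> C_per N" for \<alpha>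
    using stat[OF z that z] gsum_div_grad[OF per(6,7,8) per'(4) that]
    by (simp add: w2_def zero gsum_const left_diff_distrib gsum_diff gsum_cmult mult.assoc)
  have w2: "w2 i j k = 0" for i j k
  proof (rule grid_eq_0I[OF N _ orth2])
    show "w2 \<in> C_per N" unfolding w2_def
      by (intro C_per_minus per' per C_per_map[of _ _ "\<lambda>x. \<tau> * x"] div_grad_C_per)
  qed
  \<comment> \<open>Twice the residual of Poisson's equation, plus the constant left by the penalty.
    The load \<open>2 * (n - p)\<close> in the energy turns the increments \<open>u - n\<close> and
    \<open>v - p\<close> into the sums \<open>u + n\<close> and \<open>v + p\<close>.\<close>
  define w3 where "w3 = (\<lambda>i j k. 2 * gsum N \<psi> - 2 * laplace N \<psi> i j k
      - ((u i j k + n i j k) - (v i j k + p i j k)))"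
  text \<open>The direction \<open>(-\<kappa>, \<kappa>, \<kappa>)\<close> keeps both potentials \<open>\<mu>\<close> and \<open>\<nu>\<close> fixed.\<close>
  have orth3: "gsum N (\<lambda>i j k. w3 i j k * \<kappa> i j k) = 0" if \<kappa>: "\<kappa> \<in> C_per N" for \<kappa>
    using stat[OF C_per_map[OF \<kappa>, of uminus] \<kappa> \<kappa>] gsum_laplace[OF abc(3) \<kappa>]
    by (simp add: w3_def zero algebra_simps gsum_add gsum_diff gsum_cmult gsum_minus)
  have w3: "w3 i j k = 0" for i j k
  proof (rule grid_eq_0I[OF N _ orth3])
    have "laplace N \<psi> \<in> C_per N"
      unfolding laplace_eq_div_grad by (intro div_grad_C_per abc C_per_const)
    thus "w3 \<in> C_per N" unfolding w3_def
      by (intro C_per_minus C_per_plus per' per C_per_const C_per_map[of _ _ "\<lambda>x. 2 * x"])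
  qed
  have c1: "(\<lambda>i j k. 1) \<in> C_per N" by simp
  have one: "dirichlet N Kx Ky Kz f (\<lambda>i j k. 1) = 0" for Kx Ky Kz f
    by (simp add: dirichlet_def Dx_def Dy_def Dz_def gsum_const)
  \<comment> \<open>Constants have zero gradient, so testing with 1 shows that both masses are
    conserved. Summing \<open>w3\<close> then leaves only \<open>2 * N^3 * gsum N \<psi>\<close>,
    because the charges balance.\<close>
  have "gsum N u = gsum N n" "gsum N v = gsum N p"
    using stat[OF c1 z z] stat[OF z c1 z] by (auto simp: zero one gsum_diff gsum_const)
  moreover have "gsum N (laplace N \<psi>) = 0"
    using gsum_laplace[OF abc(3) c1] by (simp add: one)
  moreover have "gsum N w3 = 0"
    using orth3[OF c1] by simp
  ultimately have "gsum N \<psi> = 0"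
    using neutral N by (simp add: w3_def gsum_diff gsum_add gsum_cmult gsum_const)
  show thesis
  proof
    show "a \<in> C_per N" "b \<in> C_per N" "\<psi> \<in> C_per N" "gsum N \<psi> = 0" by fact+
    fix i j k
    show "cell_resp \<tau> (n i j k) (a i j k) - n i j k
        = \<tau> * div_grad N Mx My Mz (\<lambda>i j k. a i j k + \<psi> i j k) i j k"
      using w1[of i j k] by (simp add: w1_def u_def \<mu>_def)
    show "cell_resp \<tau> (p i j k) (b i j k) - p i j k
        = \<tau> * div_grad N Px Py Pz (\<lambda>i j k. b i j k - \<psi> i j k) i j k"
      using w2[of i j k] by (simp add: w2_def v_def \<nu>_def)
    show "- laplace N \<psi> i j k = (cell_resp \<tau> (n i j k) (a i j k) + n i j k) / 2
        - (cell_resp \<tau> (p i j k) (b i j k) + p i j k) / 2"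
      using w3[of i j k] \<open>gsum N \<psi> = 0\<close> unfolding w3_def u_def v_def by argo
  qed
qed

text \<open>The scheme multiplied by the time step, with the inverse Laplacian replaced by an extra
  unknown \<open>\<psi>\<close> and its Poisson equation. The sign of \<open>\<psi>\<close> flips in
  the second equation because the inverse Laplacian is odd in its argument.\<close>

definition coupled_solution :: "grid \<Rightarrow> grid \<Rightarrow> grid \<Rightarrow> bool" where
  "coupled_solution u v \<psi> \<longleftrightarrow>
     u \<in> C_per N \<and> v \<in> C_per N \<and> \<psi> \<in> C_per N \<and> gsum N \<psi> = 0 \<and>
     (\<forall>i j k. u i j k > 0 \<and> v i j k > 0 \<and>
        u i j k - n i j k
          = \<tau> * div_grad N Mx My Mz (\<lambda>i j k. cell_pot \<tau> (n i j k) (u i j k) + \<psi> i j k) i j k \<and>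
        v i j k - p i j k
          = \<tau> * div_grad N Px Py Pz (\<lambda>i j k. cell_pot \<tau> (p i j k) (v i j k) - \<psi> i j k) i j k \<and>
        - laplace N \<psi> i j k = (u i j k + n i j k) / 2 - (v i j k + p i j k) / 2)"

lemma coupled_solution_exists: "\<exists>u v \<psi>. coupled_solution u v \<psi>"
proof -
  obtain a b \<psi> where *: "a \<in> C_per N" "b \<in> C_per N" "\<psi> \<in> C_per N" "gsum N \<psi> = 0"
    "\<And>i j k. cell_resp \<tau> (n i j k) (a i j k) - n i j k
           = \<tau> * div_grad N Mx My Mz (\<lambda>i j k. a i j k + \<psi> i j k) i j k"
    "\<And>i j k. cell_resp \<tau> (p i j k) (b i j k) - p i j k
           = \<tau> * div_grad N Px Py Pz (\<lambda>i j k. b i j k - \<psi> i j k) i j k"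
    "\<And>i j k. - laplace N \<psi> i j k = (cell_resp \<tau> (n i j k) (a i j k) + n i j k) / 2
           - (cell_resp \<tau> (p i j k) (b i j k) + p i j k) / 2"
    using euler_lagrange by blast
  have "coupled_solution (\<lambda>i j k. cell_resp \<tau> (n i j k) (a i j k)) (\<lambda>i j k. cell_resp \<tau> (p i j k) (b i j k)) \<psi>"
    unfolding coupled_solution_def
    using * per(1,2) C_per_map2[OF per(1) *(1), of "cell_resp \<tau>"] C_per_map2[OF per(2) *(2), of "cell_resp \<tau>"]
    by (simp add: cell_resp[OF \<tau>] pos)
  thus ?thesis by blast
qed

section \<open>Uniqueness for the coupled system\<close>

lemma cell_pot_diff_mult_nonneg:
  assumes "r > 0" "x > 0" "y > 0"
  shows "(x - y) * (cell_pot \<tau> r x - cell_pot \<tau> r y) \<ge> 0"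
    and "(x - y) * (cell_pot \<tau> r x - cell_pot \<tau> r y) = 0 \<Longrightarrow> x = y"
  using assms cell_pot_strict_mono[OF \<tau>, of r x y] cell_pot_strict_mono[OF \<tau>, of r y x]
  by (cases x y rule: linorder_cases; auto simp: zero_le_mult_iff)+

lemma coupled_solution_unique:
  assumes s: "coupled_solution u v \<psi>" and s': "coupled_solution u' v' \<psi>'"
  shows "u = u' \<and> v = v'"
proof -
  note S = s[unfolded coupled_solution_def] and S' = s'[unfolded coupled_solution_def]
  have per': "u \<in> C_per N" "v \<in> C_per N" "\<psi> \<in> C_per N" "u' \<in> C_per N" "v' \<in> C_per N" "\<psi>' \<in> C_per N"
    using S S' by auto
  define \<mu> \<mu>' \<nu> \<nu>' where "\<mu> = (\<lambda>i j k. cell_pot \<tau> (n i j k) (u i j k) + \<psi> i j k)"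
    and "\<mu>' = (\<lambda>i j k. cell_pot \<tau> (n i j k) (u' i j k) + \<psi>' i j k)"
    and "\<nu> = (\<lambda>i j k. cell_pot \<tau> (p i j k) (v i j k) - \<psi> i j k)"
    and "\<nu>' = (\<lambda>i j k. cell_pot \<tau> (p i j k) (v' i j k) - \<psi>' i j k)"
  have per'': "\<mu> \<in> C_per N" "\<mu>' \<in> C_per N" "\<nu> \<in> C_per N" "\<nu>' \<in> C_per N"
    unfolding \<mu>_def \<mu>'_def \<nu>_def \<nu>'_def
    by (intro C_per_plus C_per_minus per' C_per_map2[of _ _ _ "cell_pot \<tau>"] per)+
  define m where "m = (\<lambda>i j k. \<mu> i j k - \<mu>' i j k)"
  define l where "l = (\<lambda>i j k. \<nu> i j k - \<nu>' i j k)"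
  define q where "q = (\<lambda>i j k. \<psi> i j k - \<psi>' i j k)"
  have per3: "m \<in> C_per N" "l \<in> C_per N" "q \<in> C_per N"
    unfolding m_def l_def q_def by (intro C_per_minus per' per'')+
  have 1: "u i j k - u' i j k = \<tau> * div_grad N Mx My Mz m i j k"
    and 2: "v i j k - v' i j k = \<tau> * div_grad N Px Py Pz l i j k"
    and 3: "(u i j k - u' i j k) - (v i j k - v' i j k) = - (2 * laplace N q i j k)" for i j k
  proof -
    have "u i j k - n i j k = \<tau> * div_grad N Mx My Mz \<mu> i j k"
      "u' i j k - n i j k = \<tau> * div_grad N Mx My Mz \<mu>' i j k"
      using S S' by (auto simp: \<mu>_def \<mu>'_def)
    thus "u i j k - u' i j k = \<tau> * div_grad N Mx My Mz m i j k"
      by (simp add: m_def div_grad_diff algebra_simps)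
    have "v i j k - p i j k = \<tau> * div_grad N Px Py Pz \<nu> i j k"
      "v' i j k - p i j k = \<tau> * div_grad N Px Py Pz \<nu>' i j k"
      using S S' by (auto simp: \<nu>_def \<nu>'_def)
    thus "v i j k - v' i j k = \<tau> * div_grad N Px Py Pz l i j k"
      by (simp add: l_def div_grad_diff algebra_simps)
    have "- laplace N \<psi> i j k = (u i j k + n i j k) / 2 - (v i j k + p i j k) / 2"
      "- laplace N \<psi>' i j k = (u' i j k + n i j k) / 2 - (v' i j k + p i j k) / 2"
      using S S' by auto
    thus "(u i j k - u' i j k) - (v i j k - v' i j k) = - (2 * laplace N q i j k)"
      unfolding q_def laplace_diff by argo
  qed
  define f where "f = (\<lambda>i j k. (u i j k - u' i j k) * (cell_pot \<tau> (n i j k) (u i j k) - cell_pot \<tau> (n i j k) (u' i j k)))"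
  define g where "g = (\<lambda>i j k. (v i j k - v' i j k) * (cell_pot \<tau> (p i j k) (v i j k) - cell_pot \<tau> (p i j k) (v' i j k)))"
  have fg0: "f i j k \<ge> 0" "g i j k \<ge> 0" for i j k
    using S S' pos unfolding f_def g_def by (auto intro!: cell_pot_diff_mult_nonneg)
  have perfg: "f \<in> C_per N" "g \<in> C_per N"
    unfolding f_def g_def by (rule C_perI; simp add: C_perD(1-3)[OF per'(1)] C_perD(1-3)[OF per'(2)]
       C_perD(1-3)[OF per'(4)] C_perD(1-3)[OF per'(5)] C_perD(1-3)[OF per(1)] C_perD(1-3)[OF per(2)])+
  \<comment> \<open>The potential difference \<open>q\<close> enters \<open>m\<close> and
    \<open>l\<close> with opposite signs, so it is paired with the difference of the charges;
    Poisson's equation turns this pairing into the Laplacian of \<open>q\<close> tested with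
    \<open>q\<close>.\<close>
  have "(u i j k - u' i j k) * m i j k + (v i j k - v' i j k) * l i j k
      = f i j k + g i j k + ((u i j k - u' i j k) - (v i j k - v' i j k)) * q i j k" for i j k
    unfolding f_def g_def m_def l_def q_def \<mu>_def \<mu>'_def \<nu>_def \<nu>'_def by (simp add: algebra_simps)
  hence "f i j k + g i j k = \<tau> * (div_grad N Mx My Mz m i j k * m i j k)
      + \<tau> * (div_grad N Px Py Pz l i j k * l i j k) + 2 * (laplace N q i j k * q i j k)" for i j k
    unfolding 3 unfolding 1 2 by (simp add: algebra_simps)
  \<comment> \<open>Green's formula makes every term on the right nonpositive, while
    \<open>f\<close> and \<open>g\<close> are nonnegative by monotonicity.\<close>
  hence "gsum N f + gsum N g = - \<tau> * dirichlet N Mx My Mz m m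
      - \<tau> * dirichlet N Px Py Pz l l - 2 * dirichlet1 N q q"
    unfolding gsum_add[symmetric]
    by (simp add: gsum_add gsum_cmult gsum_laplace gsum_div_grad per per3)
  moreover have "\<tau> * dirichlet N Mx My Mz m m \<ge> 0" "\<tau> * dirichlet N Px Py Pz l l \<ge> 0"
    using \<tau> nonneg by (auto intro!: mult_nonneg_nonneg dirichlet_nonneg)
  moreover have "gsum N f \<ge> 0" "gsum N g \<ge> 0" by (intro gsum_nonneg fg0)+
  ultimately have "gsum N f \<le> 0" "gsum N g \<le> 0"
    using dirichlet1_nonneg[of N q] by auto
  hence "f i j k = 0" "g i j k = 0" for i j k
    using gsum_eq_0D[OF N perfg(1) fg0(1)] gsum_eq_0D[OF N perfg(2) fg0(2)] by auto
  hence "u i j k = u' i j k" "v i j k = v' i j k" for i j k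
    using S S' pos unfolding f_def g_def by (meson cell_pot_diff_mult_nonneg(2))+
  thus ?thesis by (auto simp: fun_eq_iff)
qed

end

text \<open>With zero mobilities the coupled system reduces to Poisson's equation.\<close>

lemma poisson_solvable:
  assumes N: "N \<ge> 1" and f: "f \<in> C_per N" "gsum N f = 0"
  shows "\<exists>\<psi>\<in>C_per N. gsum N \<psi> = 0 \<and> (\<forall>i j k. - laplace N \<psi> i j k = f i j k)"
proof -
  \<comment> \<open>Two positive densities with difference \<open>f\<close>; their total sums agree
    because \<open>f\<close> sums to zero.\<close>
  let ?n = "\<lambda>i j k. \<bar>f i j k\<bar> + 1" and ?p = "\<lambda>i j k. \<bar>f i j k\<bar> + 1 - f i j k"
  let ?z = "\<lambda>i j k. 0"
  interpret two_species N 1 ?n ?p ?z ?z ?z ?z ?z ?z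
  proof
    show "?n \<in> C_per N" "?p \<in> C_per N"
      by (rule C_per_map[OF f(1)])+
    show "gsum N ?n = gsum N ?p" using f(2) by (simp add: gsum_add gsum_diff)
  qed (use N in auto)
  obtain u v \<psi> where "coupled_solution u v \<psi>" using coupled_solution_exists by blast
  hence *: "\<psi> \<in> C_per N" "gsum N \<psi> = 0" "\<And>i j k. u i j k = ?n i j k" "\<And>i j k. v i j k = ?p i j k"
    "\<And>i j k. - laplace N \<psi> i j k = (u i j k + ?n i j k) / 2 - (v i j k + ?p i j k) / 2"
    by (auto simp: coupled_solution_def div_grad_def dx_def dy_def dz_def)
  \<comment> \<open>Zero weights freeze the densities at \<open>?n\<close> and \<open>?p\<close>, so
    the averages on the right reduce to \<open>?n - ?p = f\<close>.\<close>
  have "- laplace N \<psi> i j k = f i j k" for i j k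
    using *(3-5)[of i j k] by argo
  thus ?thesis using *(1,2) by blast
qed

section \<open>The scheme as an instance of the coupled system\<close>

lemma mobx_C_per: "f \<in> C_per N \<Longrightarrow> g \<in> C_per N \<Longrightarrow> mobx \<tau> f g \<in> C_per N"
  and moby_C_per: "f \<in> C_per N \<Longrightarrow> g \<in> C_per N \<Longrightarrow> moby \<tau> f g \<in> C_per N"
  and mobz_C_per: "f \<in> C_per N \<Longrightarrow> g \<in> C_per N \<Longrightarrow> mobz \<tau> f g \<in> C_per N"
  by (rule C_perI; simp add: mobx_def moby_def mobz_def Ax_def Ay_def Az_def C_perD)+

theorem theorem3p1:
  fixes N :: nat and \<Delta>t D :: real and n0 n1 p0 p1 :: grid
  assumes "\<Delta>t > 0" and "D > 0" and "N \<ge> 1"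
    and "n1 \<in> C_per N" and "n0 \<in> C_per N" and "p1 \<in> C_per N" and "p0 \<in> C_per N"
    and "grid_pos N n1" and "grid_pos N n0" and "grid_pos N p1" and "grid_pos N p0"
    and "n1 - p1 \<in> C0_per N" and "n0 - p0 \<in> C0_per N"
  shows "\<exists>!(n2, p2). n2 \<in> C_per N \<and> p2 \<in> C_per N \<and>
           scheme N \<Delta>t D n0 n1 p0 p1 n2 p2 \<and>
           grid_pos N n2 \<and> grid_pos N p2 \<and> n2 - p2 \<in> C0_per N"
proof -
  note N = \<open>N \<ge> 1\<close>
  have C0: "f - g \<in> C0_per N \<longleftrightarrow> gsum N f = gsum N g" if "f \<in> C_per N" "g \<in> C_per N" for f g
    using C_per_diff[OF that] by (simp add: C0_per_def grid_mean_eq_0_iff[OF N] gsum_diff fun_diff_def)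
  interpret two_species N \<Delta>t n1 p1
    "mobx \<Delta>t (mob_n n1) (mob_n n0)" "moby \<Delta>t (mob_n n1) (mob_n n0)" "mobz \<Delta>t (mob_n n1) (mob_n n0)"
    "mobx \<Delta>t (mob_p D p1) (mob_p D p0)" "moby \<Delta>t (mob_p D p1) (mob_p D p0)"
    "mobz \<Delta>t (mob_p D p1) (mob_p D p0)"
  proof
    show "gsum N n1 = gsum N p1" using C0 assms by blast
    show "n1 i j k > 0" "p1 i j k > 0" for i j k
      using grid_pos_C_per[OF N] assms by auto
    have mob: "mob_n f \<in> C_per N" "mob_p D f \<in> C_per N" if "f \<in> C_per N" for f
      using that C_per_map[OF that, of "\<lambda>x. D * x"] by (auto simp: mob_n_def mob_p_def)
    show "mobx \<Delta>t (mob_n n1) (mob_n n0) \<in> C_per N" "moby \<Delta>t (mob_n n1) (mob_n n0) \<in> C_per N"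
      "mobz \<Delta>t (mob_n n1) (mob_n n0) \<in> C_per N"
      "mobx \<Delta>t (mob_p D p1) (mob_p D p0) \<in> C_per N" "moby \<Delta>t (mob_p D p1) (mob_p D p0) \<in> C_per N"
      "mobz \<Delta>t (mob_p D p1) (mob_p D p0) \<in> C_per N"
      using assms by (auto intro!: mobx_C_per moby_C_per mobz_C_per mob)
  qed (use assms in \<open>auto simp: mobx_def moby_def mobz_def\<close>)
  \<comment> \<open>A mean-zero solution of Poisson's equation allows both inverse Laplacians in the
    scheme to be evaluated: to \<open>\<psi>\<close> for the first species and to
    \<open>- \<psi>\<close> for the second.\<close>
  have chem: "chem_pot N \<Delta>t u n1 v p1 = (\<lambda>i j k. cell_pot \<Delta>t (n1 i j k) (u i j k) + \<psi> i j k)"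
    "chem_pot N \<Delta>t v p1 u n1 = (\<lambda>i j k. cell_pot \<Delta>t (p1 i j k) (v i j k) - \<psi> i j k)"
    if \<psi>: "\<psi> \<in> C_per N" "gsum N \<psi> = 0"
      and eq: "\<And>i j k. - laplace N \<psi> i j k = (u i j k + n1 i j k) / 2 - (v i j k + p1 i j k) / 2"
    for u v \<psi>
  proof -
    have "inv_neg_laplace N (mid u n1 - mid v p1) = \<psi>"
      by (rule inv_neg_laplace_eqI[OF N \<psi>]) (use eq in \<open>simp add: mid_def\<close>)
    thus "chem_pot N \<Delta>t u n1 v p1 = (\<lambda>i j k. cell_pot \<Delta>t (n1 i j k) (u i j k) + \<psi> i j k)"
      by (auto simp: chem_pot_def cell_pot_def fun_eq_iff)
    have "inv_neg_laplace N (mid v p1 - mid u n1) = (\<lambda>i j k. - \<psi> i j k)"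
    proof (rule inv_neg_laplace_eqI[OF N])
      show "(\<lambda>i j k. - \<psi> i j k) \<in> C_per N" by (rule C_per_map[OF \<psi>(1)])
      show "gsum N (\<lambda>i j k. - \<psi> i j k) = 0" using \<psi>(2) by (simp add: gsum_minus)
      show "- laplace N (\<lambda>i j k. - \<psi> i j k) i j k = (mid v p1 - mid u n1) i j k" for i j k
        using eq[of i j k] by (simp add: laplace_minus mid_def)
    qed
    thus "chem_pot N \<Delta>t v p1 u n1 = (\<lambda>i j k. cell_pot \<Delta>t (p1 i j k) (v i j k) - \<psi> i j k)"
      by (auto simp: chem_pot_def cell_pot_def fun_eq_iff)
  qed
  have iff: "(u \<in> C_per N \<and> v \<in> C_per N \<and> scheme N \<Delta>t D n0 n1 p0 p1 u v \<and>
      grid_pos N u \<and> grid_pos N v \<and> u - v \<in> C0_per N) \<longleftrightarrow> (\<exists>\<psi>. coupled_solution u v \<psi>)" for u v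
  proof
    assume "\<exists>\<psi>. coupled_solution u v \<psi>"
    then obtain \<psi> where W: "coupled_solution u v \<psi>" by blast
    note W' = W[unfolded coupled_solution_def]
    have uv: "u \<in> C_per N" "v \<in> C_per N" "\<psi> \<in> C_per N" "gsum N \<psi> = 0" using W' by auto
    have L: "- laplace N \<psi> i j k = (u i j k + n1 i j k) / 2 - (v i j k + p1 i j k) / 2" for i j k
      using W' by blast
    have "scheme N \<Delta>t D n0 n1 p0 p1 u v"
      unfolding scheme_def chem[OF uv(3,4) L] using W' \<tau> by simp
    moreover have "grid_pos N u" "grid_pos N v" using W' by (auto simp: grid_pos_def)
    \<comment> \<open>Poisson's equation is summed over one period. The Laplacian sums to zero, so
      neutrality of the old densities passes to the new ones.\<close>
    moreover have "gsum N u = gsum N v"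
    proof -
      have "u i j k - v i j k = - 2 * (laplace N \<psi> i j k * 1) - (n1 i j k - p1 i j k)" for i j k
        using L[of i j k] by argo
      hence "gsum N u - gsum N v = - 2 * gsum N (\<lambda>i j k. laplace N \<psi> i j k * 1) - (gsum N n1 - gsum N p1)"
        unfolding gsum_diff[symmetric] by (simp only: gsum_diff gsum_cmult)
      also have "gsum N (\<lambda>i j k. laplace N \<psi> i j k * 1) = 0"
        unfolding gsum_laplace[OF uv(3) C_per_const]
        by (simp add: dirichlet_def Dx_def Dy_def Dz_def gsum_const)
      finally show ?thesis using neutral by simp
    qed
    ultimately show "u \<in> C_per N \<and> v \<in> C_per N \<and> scheme N \<Delta>t D n0 n1 p0 p1 u v \<and>
      grid_pos N u \<and> grid_pos N v \<and> u - v \<in> C0_per N"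
      using uv C0 by blast
  next
    assume A: "u \<in> C_per N \<and> v \<in> C_per N \<and> scheme N \<Delta>t D n0 n1 p0 p1 u v \<and>
      grid_pos N u \<and> grid_pos N v \<and> u - v \<in> C0_per N"
    \<comment> \<open>The definite description \<open>inv_neg_laplace\<close> is informative only if
      a solution exists. Neutrality at both time levels makes \<open>f\<close> sum to zero, so
      solvability of Poisson's equation provides the potential.\<close>
    define f where "f = (\<lambda>i j k. (u i j k + n1 i j k) / 2 - (v i j k + p1 i j k) / 2)"
    have f: "f \<in> C_per N" unfolding f_def
      by (intro C_per_minus C_per_map2[of _ _ _ "\<lambda>x y. (x + y) / 2"]) (use A per in auto)
    have "f = (\<lambda>i j k. 1 / 2 * ((u i j k + n1 i j k) - (v i j k + p1 i j k)))"
      by (simp add: f_def fun_eq_iff field_simps)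
    hence "gsum N f = 0"
      using A C0 neutral by (simp only: gsum_cmult gsum_diff gsum_add) auto
    then obtain \<psi> where \<psi>: "\<psi> \<in> C_per N" "gsum N \<psi> = 0"
      and L: "\<And>i j k. - laplace N \<psi> i j k = (u i j k + n1 i j k) / 2 - (v i j k + p1 i j k) / 2"
      using poisson_solvable[OF N f] unfolding f_def by blast
    have pos: "u i j k > 0" "v i j k > 0" for i j k
      using A grid_pos_C_per[OF N] by auto
    have S: "scheme N \<Delta>t D n0 n1 p0 p1 u v" using A by blast
    have *: "x = \<Delta>t * y" if "x / \<Delta>t = y" for x y
      using that \<tau> by auto
    have "coupled_solution u v \<psi>"
      unfolding coupled_solution_def
      by (intro conjI allI * L pos \<psi>) (use A S[unfolded scheme_def chem[OF \<psi> L]] in blast)+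
    thus "\<exists>\<psi>. coupled_solution u v \<psi>" by blast
  qed
  show ?thesis
    unfolding Ex1_def split_paired_Ex split_paired_All case_prod_conv iff
    using coupled_solution_exists coupled_solution_unique by blast
qed

end
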